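(* Let $q$ be a prime power not divisible by $3$, and let $\epsilon=\left(\frac{q}{3}\right)$. Let $B\subset\mathbb{P}^4$ be the quartic threefold over $\mathbb{F}_q$ defined by $$y_0(y_0^3+y_1^3+y_2^3+y_3^3+y_4^3)+3y_1y_2y_3y_4=0.$$ Then $$Z(B/\mathbb{F}_q,T)=\frac{(1-qT)^{15}(1-\epsilon qT)^{14}}{(1-T)(1-q^2T)^{10}(1-\epsilon q^2T)^6(1-q^3T)}.$$
   Context: For an algebraic variety $X$ over $\mathbb{F}_q$ (not necessarily closed), the zeta function is the formal power series $Z(X/\mathbb{F}_q,T)=\exp\left(\sum_{n=1}^\infty \#X(\mathbb{F}_{q^n})\frac{T^n}{n}\right)$. The symbol $\left(\frac{q}{3}\right)$ is the Legendre symbol: it equals $1$ if $q\equiv1\pmod 3$ and $-1$ if $q\equiv 2\pmod 3$. *)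

theory Defs
  imports
    "HOL-Analysis.Finite_Cartesian_Product"
    "HOL-Algebra.Algebraic_Closure_Type"
    "HOL-Number_Theory.Number_Theory"
begin

no_notation fps_nth (infixl \<open>$\<close> 75)

text \<open>
  The base field \<open>\<F>\<^sub>q\<close> is a type \<open>'k\<close> of class \<open>finite_field\<close>, with \<open>q = CARD('k)\<close>.
  Varieties over it are given by their geometric points, i.e. as sets of points over \<open>'k alg_closure\<close>.
\<close>

text \<open>
  The unique subfield with \<open>q\<^sup>n\<close> elements (\<open>n \<ge> 1\<close>) of the algebraic closure, as the set of
  roots of \<open>X\<^bsup>q^n\<^esup> - X\<close>.
\<close>

definition finite_extension :: "nat \<Rightarrow> 'k :: finite_field alg_closure set" where
  "finite_extension n = {x. x ^ (CARD('k) ^ n) = x}"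

lemma card_finite_extension:
  assumes "n > 0"
  shows "card (finite_extension n :: 'k :: finite_field alg_closure set) = CARD('k) ^ n"
proof -
  define m where "m = CARD('k) ^ n"
  have "card {0, 1 :: 'k} \<le> CARD('k)"
    by (rule card_mono) auto
  hence q: "CARD('k) > 1"
    by simp
  with assms have m: "m > 1"
    unfolding m_def by (intro one_less_power)
  have "CHAR('k) dvd m"
    unfolding m_def using CHAR_dvd_CARD[where ?'a = 'k] assms by (meson dvd_power dvd_trans)
  hence m0: "of_nat m = (0 :: 'k alg_closure)"
    by (simp add: of_nat_eq_0_iff_char_dvd)
  define p :: "'k alg_closure poly" where "p = monom 1 m - monom 1 1"
  have deg: "degree p = m"
    using m degree_add_eq_left[of "- monom 1 1" "monom (1 :: 'k alg_closure) m"]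
    by (simp add: p_def degree_monom_eq)
  hence nz: "p \<noteq> 0"
    using m by auto
  have root: "poly p x = 0 \<longleftrightarrow> x ^ m = x" for x
    by (simp add: p_def poly_monom)
  have deriv: "pderiv p = - 1"
    unfolding p_def by (simp add: pderiv_diff pderiv_monom m0 monom_eq_1)
  have order: "order a p \<le> 1" for a
  proof (rule ccontr)
    assume "\<not> order a p \<le> 1"
    hence "[:-a, 1:] ^ 2 dvd p"
      using order_1[of a p] dvd_trans[OF le_imp_power_dvd[of 2 "order a p" "[:-a, 1:]"]] by simp
    then obtain r where "p = [:-a, 1:] ^ 2 * r"
      by (elim dvdE)
    hence "poly (pderiv p) a = 0"
      unfolding power2_eq_square by (simp add: pderiv_mult del: mult_pCons_left mult_pCons_right)
    with deriv show False
      by simp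
  qed
  obtain A where A: "size A = degree p" "p = smult (lead_coeff p) (\<Prod>x\<in>#A. [:-x, 1:])"
    using alg_closed_imp_factorization[OF nz] by blast
  have "proots (\<Prod>x\<in>#A. [:-x, 1:]) = A" for A :: "'k alg_closure multiset"
  proof (induction A)
    case (add x A)
    have "(\<Prod>x\<in>#A. [:-x, 1:]) \<noteq> 0"
      by (simp add: prod_mset_zero_iff image_iff)
    hence "proots ([:-x, 1:] * (\<Prod>x\<in>#A. [:-x, 1:])) = {#x#} + A"
      by (subst proots_mult) (simp_all add: add.IH)
    thus ?case
      by (simp del: mult_pCons_left)
  qed simp
  hence roots: "proots p = A"
    by (subst A(2), subst proots_smult) (use nz in simp_all)
  have "order x p = (if poly p x = 0 then 1 else 0)" for x
    using order[of x] nz by (auto simp: order_root)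
  hence "A = mset_set {x. poly p x = 0}"
    unfolding roots [symmetric]
    using nz by (intro multiset_eqI) (auto simp: count_mset_set' poly_roots_finite)
  hence "card {x. poly p x = 0} = m"
    using A(1) deg size_mset_set by metis
  thus ?thesis
    by (simp add: root finite_extension_def m_def)
qed

text \<open>
  A point of projective space is the set of its homogeneous coordinate vectors, all of them
  nonzero.
\<close>

definition proj_point :: "'a :: field ^ 'n \<Rightarrow> ('a ^ 'n) set" where
  "proj_point y = {c *s y | c. c \<noteq> 0}"

definition proj_space :: "('a :: field ^ 'n) set set" where
  "proj_space = {proj_point y | y. y \<noteq> 0}"

text \<open>
  For \<open>V\<close> contained in projective space, \<open>V(\<F>\<^bsub>q^n\<^esub>)\<close> consists of the points of \<open>V\<close> that have
  homogeneous coordinates in \<open>\<F>\<^bsub>q^n\<^esub>\<close>.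
\<close>

definition rational_points ::
    "('k :: finite_field alg_closure ^ 'n) set set \<Rightarrow> nat \<Rightarrow> ('k alg_closure ^ 'n) set set" where
  "rational_points V n = {P \<in> V. \<exists>y \<in> P. \<forall>i. y $ i \<in> finite_extension n}"

definition zeta_function ::
    "('k :: finite_field alg_closure ^ 'n) set set \<Rightarrow> rat fps" where
  "zeta_function V =
     fps_exp 1 oo
       Abs_fps (\<lambda>n. if n = 0 then 0 else of_nat (card (rational_points V n)) / of_nat n)"

definition burkhardt_form :: "'a :: field ^ 5 \<Rightarrow> 'a" where
  "burkhardt_form y =
     y $ 0 * ((y $ 0) ^ 3 + (y $ 1) ^ 3 + (y $ 2) ^ 3 + (y $ 3) ^ 3 + (y $ 4) ^ 3)
       + 3 * y $ 1 * y $ 2 * y $ 3 * y $ 4"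

text \<open>The form is homogeneous, so its vanishing does not depend on the choice of coordinates.\<close>

definition burkhardt_quartic :: "('a :: field ^ 5) set set" where
  "burkhardt_quartic = {P \<in> proj_space. \<forall>y \<in> P. burkhardt_form y = 0}"

end

(*
Since B is homogeneous, it suffices to count the affine cone over B in K^5, K = F_Q with Q = q^n.
The part y0 = 0 is y1 y2 y3 y4 = 0. For y0 = 1 and y4 = -s the equation becomes
x^3 + y^3 + z^3 - 3 s x y z = s^3 - 1, a one-parameter family of affine cubic surfaces.

If Q = 2 mod 3, cubing is bijective on K, so by scaling the form on the left takes all nonzero values
equally often; summing over s then only requires counting its zeros, where s occurs linearly.

If Q = 1 mod 3, let w be a primitive cube root of unity. In the coordinates
p = sx + y + z, q = sx + wy + w^2 z, r = sx + w^2 y + w z the surface is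
pqr = (s^3 - 1)(1 + x)(1 + wx)(1 + w^2 x), p + q + r = 3sx. Putting p = l (1 + x), q = m (1 + wx),
r = k (1 + w^2 x), the condition lmk = s^3 - 1 defines a torus, and the remaining condition is linear
in x. It degenerates along the Hesse cubic u^3 + v^3 + 1 = 3suv, whose number of points is not
elementary for fixed s, but is so after summation over s, as s occurs linearly.
*)

theory Submission
  imports Defs
begin

section \<open>Double counting of finite sets\<close>

lemma int_card_Diff:
  assumes "finite A" "B \<subseteq> A"
  shows "int (card (A - B)) = int (card A) - int (card B)"
  using assms by (simp add: card_Diff_subset finite_subset card_mono of_nat_diff)

lemma card_as_sum:
  assumes "finite A"
  shows "int (card {a \<in> A. P a}) = (\<Sum>a\<in>A. of_bool (P a))"
proof -
  have "{a \<in> A. P a} = A \<inter> {a. P a}" by auto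
  thus ?thesis using assms by simp
qed

text \<open>Both sides count the pairs related by \<open>R\<close>. The exchange is used where one
  variable occurs linearly: with the others fixed, the inner count is the number of solutions of a
  single linear equation.\<close>

lemma sum_card_swap:
  assumes "finite A" "finite B"
  shows "(\<Sum>a\<in>A. int (card {b \<in> B. R a b})) = (\<Sum>b\<in>B. int (card {a \<in> A. R a b}))"
  unfolding card_as_sum[OF assms(1)] card_as_sum[OF assms(2)] by (rule sum.swap)

section \<open>Counting over a finite subfield\<close>

text \<open>The subfield is a set inside an ambient field, so that \<open>finite_extension n\<close>
  can be treated for all n within the one type of the algebraic closure.\<close>

locale finite_subfield =
  fixes K :: "'a :: field set"
  assumes finite_K [simp]: "finite K"
    and zero_K [simp]: "0 \<in> K" and one_K [simp]: "1 \<in> K"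
    and add_K [simp]: "x \<in> K \<Longrightarrow> y \<in> K \<Longrightarrow> x + y \<in> K"
    and minus_K [simp]: "x \<in> K \<Longrightarrow> - x \<in> K"
    and mult_K [simp]: "x \<in> K \<Longrightarrow> y \<in> K \<Longrightarrow> x * y \<in> K"
    and inverse_K [simp]: "x \<in> K \<Longrightarrow> inverse x \<in> K"
    and three_nz [simp]: "(3 :: 'a) \<noteq> 0"
begin

abbreviation Q :: int where "Q \<equiv> int (card K)"

abbreviation K0 :: "'a set" where "K0 \<equiv> K - {0}"

lemma diff_K [simp]: "x \<in> K \<Longrightarrow> y \<in> K \<Longrightarrow> x - y \<in> K"
  using add_K[of x "- y"] by simp

lemma divide_K [simp]: "x \<in> K \<Longrightarrow> y \<in> K \<Longrightarrow> x / y \<in> K"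
  using mult_K[of x "inverse y"] by (simp add: divide_inverse)

lemma power_K [simp]: "x \<in> K \<Longrightarrow> x ^ n \<in> K"
  by (induction n) auto

lemma of_nat_K [simp]: "of_nat n \<in> K"
  by (induction n) auto

lemma numeral_K [simp]: "numeral n \<in> K"
  using of_nat_K[of "numeral n"] by simp

lemma card_K_ge_2: "card K \<ge> 2"
  using card_mono[of K "{0, 1}"] by simp

lemma int_card_K_minus [simp]: "int (card K - Suc 0) = Q - 1"
  using card_K_ge_2 by (simp add: of_nat_diff)

lemma card_Sigma_K:
  assumes "finite A" "\<And>x. x \<in> A \<Longrightarrow> finite (S x)"
  shows "int (card (Sigma A S)) = (\<Sum>x\<in>A. int (card (S x)))"
  using assms by (simp add: card_SigmaI)

lemma card_linear:
  assumes "a \<in> K" "b \<in> K" "a \<noteq> 0"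
  shows "card {x \<in> K. a * x = b} = 1"
proof -
  have "{x \<in> K. a * x = b} = {b / a}"
    using assms by (auto simp: field_simps)
  thus ?thesis by simp
qed

lemma card_prod_zero3:
  "int (card {(p, q, r). p \<in> K \<and> q \<in> K \<and> r \<in> K \<and> p * q * r = 0}) = 3 * Q ^ 2 - 3 * Q + 1"
proof -
  have eq: "{(p, q, r). p \<in> K \<and> q \<in> K \<and> r \<in> K \<and> p * q * r = 0} = K \<times> K \<times> K - K0 \<times> K0 \<times> K0"
    by auto
  have "int (card (K \<times> K \<times> K - K0 \<times> K0 \<times> K0)) = int (card (K \<times> K \<times> K)) - int (card (K0 \<times> K0 \<times> K0))"
    by (rule int_card_Diff) auto
  also have "\<dots> = Q ^ 3 - (Q - 1) ^ 3"
    by (simp add: card_cartesian_product power3_eq_cube)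
  finally show ?thesis unfolding eq by (simp add: power3_eq_cube power2_eq_square algebra_simps)
qed

text \<open>Three lines in the plane p + q + r = e: p = 0 gives Q points, q = 0 with p nonzero gives
  Q - 1. What remains of r = 0 depends on whether e vanishes and stays uncounted, since the same set
  reappears for \<open>scaled_fibre\<close> in \<open>card_fibre_special\<close>.\<close>

lemma card_prod_zero_plane:
  assumes "e \<in> K"
  shows "int (card {(p, q, r). p \<in> K \<and> q \<in> K \<and> r \<in> K \<and> p + q + r = e \<and> p * q * r = 0})
    = 2 * Q - 1 + int (card {(m, k). m \<in> K0 \<and> k \<in> K0 \<and> m + k = e})"
proof -
  let ?P = "{(p, q, r). p \<in> K \<and> q \<in> K \<and> r \<in> K \<and> p + q + r = e \<and> p * q * r = 0}"
  let ?A = "(\<lambda>q. (0 :: 'a, q, e - q)) ` K" and ?B = "(\<lambda>p. (p, 0 :: 'a, e - p)) ` K0"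
  let ?C = "(\<lambda>(m, k). (m, k, 0 :: 'a)) ` {(m, k). m \<in> K0 \<and> k \<in> K0 \<and> m + k = e}"
  have "?P = ?A \<union> (?B \<union> ?C)"
    using assms by (auto simp: image_iff algebra_simps)
  moreover have fin: "finite {(m, k). m \<in> K0 \<and> k \<in> K0 \<and> m + k = e}"
    by (rule finite_subset[of _ "K \<times> K"]) auto
  moreover have "?A \<inter> (?B \<union> ?C) = {}" "?B \<inter> ?C = {}" by auto
  ultimately have "card ?P = card ?A + (card ?B + card ?C)"
    by (simp only: card_Un_disjoint finite_imageI finite_UnI finite_K finite_Diff)
  moreover have "card ?A = card K" "card ?B = card K0"
    by (rule card_image, rule inj_onI, simp)+
  moreover have "card ?C = card {(m, k). m \<in> K0 \<and> k \<in> K0 \<and> m + k = e}"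
    by (auto intro!: card_image inj_onI)
  ultimately show ?thesis by simp
qed

lemma card_nonzero_sum:
  assumes "e \<in> K" "e \<noteq> 0"
  shows "int (card {(m, k). m \<in> K0 \<and> k \<in> K0 \<and> m + k = e}) = Q - 2"
proof -
  have "{(m, k). m \<in> K0 \<and> k \<in> K0 \<and> m + k = e} = (\<lambda>m. (m, e - m)) ` (K0 - {e})"
    using assms by (auto simp: image_iff algebra_simps)
  moreover have "card ((\<lambda>m. (m, e - m)) ` (K0 - {e})) = card (K0 - {e})"
    by (auto intro!: card_image inj_onI)
  moreover have "int (card (K0 - {e})) = Q - 2"
    using assms card_K_ge_2 by (simp add: of_nat_diff card_Diff_singleton)
  ultimately show ?thesis by simp
qed

lemma card_units_prod:
  assumes "c \<in> K0"
  shows "int (card {(l, m, k). l \<in> K \<and> m \<in> K \<and> k \<in> K \<and> l * m * k = c}) = (Q - 1) ^ 2"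
proof -
  have "bij_betw (\<lambda>(l, m, k). (l, m)) {(l, m, k). l \<in> K \<and> m \<in> K \<and> k \<in> K \<and> l * m * k = c} (K0 \<times> K0)"
    by (rule bij_betw_byWitness[where f' = "\<lambda>(l, m). (l, m, c / (l * m))"]) (use assms in auto)
  thus ?thesis by (simp add: bij_betw_same_card card_cartesian_product power2_eq_square)
qed

text \<open>The chart \<open>y\<^sub>0 = 1\<close>, \<open>y\<^sub>4 = - s\<close> of the quartic.\<close>

definition affine_cubics :: "'a \<Rightarrow> ('a \<times> 'a \<times> 'a) set" where
  "affine_cubics s = {(x, y, z). x \<in> K \<and> y \<in> K \<and> z \<in> K \<and>
     x ^ 3 + y ^ 3 + z ^ 3 - 3 * s * x * y * z = s ^ 3 - 1}"

text \<open>Affine part of a member of the Hesse pencil of plane cubics.\<close>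

definition hesse :: "'a \<Rightarrow> ('a \<times> 'a) set" where
  "hesse s = {(u, v). u \<in> K \<and> v \<in> K \<and> u ^ 3 + v ^ 3 + 1 = 3 * s * u * v}"

end

section \<open>Fields with a primitive cube root of unity\<close>

locale finite_subfield_omega = finite_subfield +
  fixes \<omega> :: 'a
  assumes omega_K [simp]: "\<omega> \<in> K"
    and omega: "\<omega> ^ 2 = - 1 - \<omega>"
begin

section \<open>Factorisation of cubes and the Fourier transform of order three\<close>

lemma omega_mult: "\<omega> * \<omega> = - 1 - \<omega>" "\<omega> * (\<omega> * t) = - t - \<omega> * t"
proof -
  show *: "\<omega> * \<omega> = - 1 - \<omega>"
    using omega by (simp add: power2_eq_square)
  \<comment> \<open>Needed so that the simplifier also reduces products nested to the right.\<close>
  show "\<omega> * (\<omega> * t) = - t - \<omega> * t"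
    unfolding mult.assoc[symmetric] * by (simp add: algebra_simps)
qed

lemma omega_powers: "\<omega> ^ 3 = 1" "1 + \<omega> + \<omega>\<^sup>2 = 0" "\<omega> + \<omega>\<^sup>2 = -1" "\<omega>\<^sup>2 + \<omega> ^ 4 = -1"
  using omega by (simp_all add: power3_eq_cube power4_eq_xxxx omega_mult algebra_simps)

lemma omega_nz [simp]: "\<omega> \<noteq> 0"
  using omega by auto

lemma omega_neq_1 [simp]: "\<omega> \<noteq> 1"
proof
  assume "\<omega> = 1"
  with omega have "(3 :: 'a) = 0" by (simp add: eq_diff_eq)
  thus False using three_nz by contradiction
qed

text \<open>The product of the two conjugate factors has coefficients that are power sums of
  \<omega>, hence equals a^2 + b^2 + d^2 - ab - ad - bd.\<close>

lemma sum_three_cubes: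
  "(a + b + d) * (a + \<omega> * b + \<omega>\<^sup>2 * d) * (a + \<omega>\<^sup>2 * b + \<omega> * d) = a ^ 3 + b ^ 3 + d ^ 3 - 3 * a * b * d"
proof -
  have "(a + \<omega> * b + \<omega>\<^sup>2 * d) * (a + \<omega>\<^sup>2 * b + \<omega> * d) =
      a\<^sup>2 + (\<omega> + \<omega>\<^sup>2) * (a * b + a * d) + \<omega> ^ 3 * (b\<^sup>2 + d\<^sup>2) + (\<omega>\<^sup>2 + \<omega> ^ 4) * (b * d)"
    by (simp add: algebra_simps power2_eq_square power3_eq_cube power4_eq_xxxx)
  hence "(a + b + d) * ((a + \<omega> * b + \<omega>\<^sup>2 * d) * (a + \<omega>\<^sup>2 * b + \<omega> * d)) =
      (a + b + d) * (a\<^sup>2 - (a * b + a * d) + (b\<^sup>2 + d\<^sup>2) - b * d)"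
    unfolding omega_powers by simp
  also have "\<dots> = a ^ 3 + b ^ 3 + d ^ 3 - 3 * a * b * d"
    by (simp add: algebra_simps power2_eq_square power3_eq_cube)
  finally show ?thesis by (simp only: mult.assoc)
qed

lemma cube_eq_iff: "(x :: 'a) ^ 3 = y ^ 3 \<longleftrightarrow> x = y \<or> x = \<omega> * y \<or> x = \<omega>\<^sup>2 * y"
proof -
  have "(x - \<omega> * y) * (x - \<omega>\<^sup>2 * y) = x\<^sup>2 - (\<omega> + \<omega>\<^sup>2) * (x * y) + \<omega> ^ 3 * y\<^sup>2"
    by (simp add: algebra_simps power2_eq_square power3_eq_cube)
  hence "(x - y) * ((x - \<omega> * y) * (x - \<omega>\<^sup>2 * y)) = (x - y) * (x\<^sup>2 + x * y + y\<^sup>2)"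
    unfolding omega_powers by simp
  also have "\<dots> = x ^ 3 - y ^ 3"
    by (simp add: algebra_simps power2_eq_square power3_eq_cube)
  finally show ?thesis by (metis eq_iff_diff_eq_0 mult_eq_0_iff)
qed

text \<open>Inversion of the discrete Fourier transform on three points, by 1 + \<omega> +
  \<omega>^2 = 0; the factor 3 is invertible.\<close>

lemma fourier_inverse:
  fixes p q r x y z :: 'a
  assumes "p = x + y + z" "q = x + \<omega> * y + \<omega>\<^sup>2 * z" "r = x + \<omega>\<^sup>2 * y + \<omega> * z"
  shows "x = (p + q + r) / 3" "y = (p + \<omega>\<^sup>2 * q + \<omega> * r) / 3" "z = (p + \<omega> * q + \<omega>\<^sup>2 * r) / 3"
proof -
  have "3 * x = p + q + r" "3 * y = p + \<omega>\<^sup>2 * q + \<omega> * r" "3 * z = p + \<omega> * q + \<omega>\<^sup>2 * r"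
    unfolding assms omega by (simp_all add: algebra_simps omega_mult)
  thus "x = (p + q + r) / 3" "y = (p + \<omega>\<^sup>2 * q + \<omega> * r) / 3" "z = (p + \<omega> * q + \<omega>\<^sup>2 * r) / 3"
    using three_nz by (simp_all add: eq_divide_eq mult.commute)
qed

text \<open>The inverse transform is, up to the factor 3, the transform itself with two coordinates
  exchanged. Hence the previous lemma applies with q and r swapped.\<close>

lemma fourier_inverse':
  fixes p q r x y z :: 'a
  assumes "x = (p + q + r) / 3" "y = (p + \<omega>\<^sup>2 * q + \<omega> * r) / 3" "z = (p + \<omega> * q + \<omega>\<^sup>2 * r) / 3"
  shows "p = x + y + z" "q = x + \<omega> * y + \<omega>\<^sup>2 * z" "r = x + \<omega>\<^sup>2 * y + \<omega> * z"
proof -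
  have eq: "p = (t + u + v) / 3 \<and> q = (t + \<omega> * u + \<omega>\<^sup>2 * v) / 3 \<and> r = (t + \<omega>\<^sup>2 * u + \<omega> * v) / 3"
    if "t = p + q + r" "u = p + \<omega>\<^sup>2 * q + \<omega> * r" "v = p + \<omega> * q + \<omega>\<^sup>2 * r" for t u v
    using fourier_inverse[of t p r q u v] that by (simp add: add.commute add.left_commute)
  show "p = x + y + z" "q = x + \<omega> * y + \<omega>\<^sup>2 * z" "r = x + \<omega>\<^sup>2 * y + \<omega> * z"
    unfolding assms using eq[OF refl refl refl]
    by (simp_all only: add_divide_distrib[symmetric] times_divide_eq_right)
qed

section \<open>Decomposition of the affine cubic surfaces by the coordinate x\<close>

definition fibre :: "'a \<Rightarrow> 'a \<Rightarrow> ('a \<times> 'a \<times> 'a) set" where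
  "fibre s x = {(p, q, r). p \<in> K \<and> q \<in> K \<and> r \<in> K \<and> p + q + r = 3 * s * x \<and>
     p * q * r = (s ^ 3 - 1) * (1 + x ^ 3)}"

lemma finite_fibre [simp]: "finite (fibre s x)"
  unfolding fibre_def by (rule finite_subset[of _ "K \<times> K \<times> K"]) auto

lemma card_affine_cubics:
  assumes "s \<in> K"
  shows "int (card (affine_cubics s)) = (\<Sum>x\<in>K. int (card (fibre s x)))"
proof -
  have *: "x ^ 3 + y ^ 3 + z ^ 3 - 3 * s * x * y * z = s ^ 3 - 1 \<longleftrightarrow>
    (s * x + y + z) * (s * x + \<omega> * y + \<omega>\<^sup>2 * z) * (s * x + \<omega>\<^sup>2 * y + \<omega> * z) = (s ^ 3 - 1) * (1 + x ^ 3)"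
    for x y z :: 'a
  proof -
    \<comment> \<open>Adding (s^3 - 1) x^3 to both sides of the equation turns x^3 into (s x)^3, so
      that the left side is the factorable form at s x, y, z, and the right side becomes (s^3 - 1)(1
      + x^3).\<close>
    have "(s * x) ^ 3 + y ^ 3 + z ^ 3 - 3 * (s * x) * y * z - (s ^ 3 - 1) * (1 + x ^ 3) =
      x ^ 3 + y ^ 3 + z ^ 3 - 3 * s * x * y * z - (s ^ 3 - 1)"
      by (simp add: algebra_simps)
    thus ?thesis unfolding sum_three_cubes by (metis eq_iff_diff_eq_0)
  qed
  let ?f = "\<lambda>(x, y, z). (x, s * x + y + z, s * x + \<omega> * y + \<omega>\<^sup>2 * z, s * x + \<omega>\<^sup>2 * y + \<omega> * z)"
  have "bij_betw ?f (affine_cubics s) (SIGMA x:K. fibre s x)"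
  proof (rule bij_betw_byWitness[where f' = "\<lambda>(x, p, q, r).
      (x, (p + \<omega>\<^sup>2 * q + \<omega> * r) / 3, (p + \<omega> * q + \<omega>\<^sup>2 * r) / 3)"])
    show "\<forall>a\<in>affine_cubics s. (\<lambda>(x, p, q, r).
      (x, (p + \<omega>\<^sup>2 * q + \<omega> * r) / 3, (p + \<omega> * q + \<omega>\<^sup>2 * r) / 3)) (?f a) = a"
      using fourier_inverse[OF refl refl refl] by auto
    show "\<forall>a\<in>SIGMA x:K. fibre s x. ?f ((\<lambda>(x, p, q, r).
      (x, (p + \<omega>\<^sup>2 * q + \<omega> * r) / 3, (p + \<omega> * q + \<omega>\<^sup>2 * r) / 3)) a) = a"
    proof clarsimp
      fix x p q r assume "(p, q, r) \<in> fibre s x"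
      hence "s * x = (p + q + r) / 3" unfolding fibre_def by simp
      from fourier_inverse'[OF this refl refl]
      show "s * x + (p + \<omega>\<^sup>2 * q + \<omega> * r) / 3 + (p + \<omega> * q + \<omega>\<^sup>2 * r) / 3 = p \<and>
         s * x + \<omega> * (p + \<omega>\<^sup>2 * q + \<omega> * r) / 3 + \<omega>\<^sup>2 * (p + \<omega> * q + \<omega>\<^sup>2 * r) / 3 = q \<and>
         s * x + \<omega>\<^sup>2 * (p + \<omega>\<^sup>2 * q + \<omega> * r) / 3 + \<omega> * (p + \<omega> * q + \<omega>\<^sup>2 * r) / 3 = r"
        by simp
    qed
    show "?f ` affine_cubics s \<subseteq> (SIGMA x:K. fibre s x)"
    proof clarsimp
      fix x y z assume "(x, y, z) \<in> affine_cubics s"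
      thus "x \<in> K \<and> (s * x + y + z, s * x + \<omega> * y + \<omega>\<^sup>2 * z, s * x + \<omega>\<^sup>2 * y + \<omega> * z) \<in> fibre s x"
        using assms fourier_inverse(1)[OF refl refl refl, of "s * x" y z] three_nz
        unfolding affine_cubics_def fibre_def * by (simp add: eq_divide_eq)
    qed
    show "(\<lambda>(x, p, q, r). (x, (p + \<omega>\<^sup>2 * q + \<omega> * r) / 3, (p + \<omega> * q + \<omega>\<^sup>2 * r) / 3)) ` (SIGMA x:K. fibre s x)
      \<subseteq> affine_cubics s"
    proof clarsimp
      fix x p q r assume mem: "x \<in> K" "(p, q, r) \<in> fibre s x"
      hence "s * x = (p + q + r) / 3" unfolding fibre_def by simp
      note ** = fourier_inverse'[OF this refl refl, symmetric]
      show "(x, (p + \<omega>\<^sup>2 * q + \<omega> * r) / 3, (p + \<omega> * q + \<omega>\<^sup>2 * r) / 3) \<in> affine_cubics s"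
        using mem unfolding affine_cubics_def fibre_def mem_Collect_eq prod.case * ** by simp
    qed
  qed
  hence "card (affine_cubics s) = card (SIGMA x:K. fibre s x)" by (rule bij_betw_same_card)
  thus ?thesis by simp
qed

section \<open>Cube roots of unity and the Hesse cubics\<close>

lemma cube_roots_of_minus_one: "{v \<in> K. v ^ 3 = -1} = {-1, -\<omega>, -\<omega>\<^sup>2}"
proof -
  have "v ^ 3 = -1 \<longleftrightarrow> v = -1 \<or> v = -\<omega> \<or> v = -\<omega>\<^sup>2" for v :: 'a
    using cube_eq_iff[of v "-1"] by simp
  thus ?thesis by auto
qed

lemma cube_roots_of_one: "{v \<in> K. v ^ 3 = 1} = {1, \<omega>, \<omega>\<^sup>2}"
proof -
  have "v ^ 3 = 1 \<longleftrightarrow> v = 1 \<or> v = \<omega> \<or> v = \<omega>\<^sup>2" for v :: 'a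
    using cube_eq_iff[of v 1] by simp
  thus ?thesis by auto
qed

lemma omega_distinct [simp]: "\<omega>\<^sup>2 \<noteq> 1" "\<omega>\<^sup>2 \<noteq> \<omega>"
proof -
  show "\<omega>\<^sup>2 \<noteq> \<omega>" using omega_neq_1 omega_nz by (simp add: power2_eq_square)
  show "\<omega>\<^sup>2 \<noteq> 1"
  proof
    assume "\<omega>\<^sup>2 = 1"
    hence "\<omega> ^ 3 = \<omega>" by (simp add: power3_eq_cube power2_eq_square)
    with omega_powers(1) show False by simp
  qed
qed

lemma card_cube_roots [simp]:
  "card {v \<in> K. v ^ 3 = -1} = 3" "card {v \<in> K. v ^ 3 = 1} = 3"
  unfolding cube_roots_of_minus_one cube_roots_of_one
  by (simp_all add: card_insert_if omega_distinct[symmetric] omega_neq_1[symmetric])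

text \<open>This is the Fourier transform of (u, v, s). By \<open>sum_three_cubes\<close> the
  product of the new coordinates is u^3 + v^3 + s^3 - 3uvs, which equals s^3 - 1 exactly on the
  Hesse cubic; the linear condition says that the third original coordinate is s.\<close>

lemma bij_hesse:
  assumes "s \<in> K"
  shows "bij_betw (\<lambda>(u, v). (u + v + s, u + \<omega> * v + \<omega>\<^sup>2 * s, u + \<omega>\<^sup>2 * v + \<omega> * s)) (hesse s)
    {(l, m, k). l \<in> K \<and> m \<in> K \<and> k \<in> K \<and> l * m * k = s ^ 3 - 1 \<and> l + \<omega> * m + \<omega>\<^sup>2 * k = 3 * s}"
    (is "bij_betw ?f _ ?B")
proof (rule bij_betw_byWitness[where f' = "\<lambda>(l, m, k). ((l + m + k) / 3, (l + \<omega>\<^sup>2 * m + \<omega> * k) / 3)"])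
  let ?g = "\<lambda>(l, m, k). ((l + m + k) / 3, (l + \<omega>\<^sup>2 * m + \<omega> * k) / 3)"
  show "\<forall>a\<in>hesse s. ?g (?f a) = a"
    using fourier_inverse[OF refl refl refl] by auto
  have f_g: "?f (?g t) = t" if "t \<in> ?B" for t
  proof -
    obtain l m k where t: "t = (l, m, k)" by (cases t)
    have "s = (l + \<omega> * m + \<omega>\<^sup>2 * k) / 3"
      using that three_nz by (simp add: t eq_divide_eq mult.commute)
    from fourier_inverse'[OF refl refl this] show ?thesis by (simp add: t)
  qed
  thus "\<forall>a\<in>?B. ?f (?g a) = a" by blast
  have iff: "l * m * k = s ^ 3 - 1 \<longleftrightarrow> u ^ 3 + v ^ 3 + 1 = 3 * s * u * v"
    if "(l, m, k) = ?f (u, v)" for l m k u v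
  proof -
    have "l * m * k = u ^ 3 + v ^ 3 + s ^ 3 - 3 * u * v * s"
      using that sum_three_cubes[of u v s] by simp
    hence "l * m * k - (s ^ 3 - 1) = (u ^ 3 + v ^ 3 + 1) - 3 * s * u * v"
      by (simp add: algebra_simps)
    thus ?thesis by (metis eq_iff_diff_eq_0)
  qed
  show "?f ` hesse s \<subseteq> ?B"
  proof (rule image_subsetI)
    fix t assume "t \<in> hesse s"
    then obtain u v where t: "t = (u, v)" and uv: "(u, v) \<in> hesse s" by (cases t) auto
    obtain l m k where lmk: "(l, m, k) = ?f (u, v)" by simp
    have "l + \<omega> * m + \<omega>\<^sup>2 * k = 3 * s"
      using lmk fourier_inverse(3)[of l u v s m k] three_nz by (simp add: eq_divide_eq mult.commute)
    moreover have "l * m * k = s ^ 3 - 1"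
      using iff[OF lmk] uv by (simp add: hesse_def)
    moreover have "l \<in> K" "m \<in> K" "k \<in> K"
      using lmk uv assms by (simp_all add: hesse_def)
    ultimately show "?f t \<in> ?B" unfolding t lmk[symmetric] by simp
  qed
  show "?g ` ?B \<subseteq> hesse s"
  proof (rule image_subsetI)
    fix t assume t: "t \<in> ?B"
    obtain l m k where lmk: "t = (l, m, k)" by (cases t)
    obtain u v where uv: "?g t = (u, v)" by force
    have "(l, m, k) = ?f (u, v)" using f_g[OF t] uv lmk by simp
    from iff[OF this] t have "u ^ 3 + v ^ 3 + 1 = 3 * s * u * v" by (simp add: lmk)
    moreover have "l \<in> K" "m \<in> K" "k \<in> K" using t by (simp_all add: lmk)
    hence "fst (?g t) \<in> K" "snd (?g t) \<in> K" by (simp_all add: lmk)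
    hence "u \<in> K" "v \<in> K" unfolding uv by simp_all
    ultimately show "?g t \<in> hesse s" unfolding uv by (simp add: hesse_def)
  qed
qed

lemma finite_hesse [simp]: "finite (hesse s)"
  unfolding hesse_def by (rule finite_subset[of _ "K \<times> K"]) auto

text \<open>For s^3 = 1 the transformed cubic has l m k = 0. Absorbing \<omega> and \<omega>^2 into
  m and k gives three lines in the plane p + q + r = 3s, and 3s is nonzero.\<close>

lemma card_hesse_degenerate:
  assumes "s \<in> K" "s ^ 3 = 1"
  shows "int (card (hesse s)) = 3 * Q - 3"
proof -
  let ?B = "{(l, m, k). l \<in> K \<and> m \<in> K \<and> k \<in> K \<and> l * m * k = s ^ 3 - 1 \<and> l + \<omega> * m + \<omega>\<^sup>2 * k = 3 * s}"
  let ?C = "{(p, q, r). p \<in> K \<and> q \<in> K \<and> r \<in> K \<and> p + q + r = 3 * s \<and> p * q * r = 0}"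
  have "bij_betw (\<lambda>(l, m, k). (l, \<omega> * m, \<omega>\<^sup>2 * k)) ?B ?C"
    by (rule bij_betw_byWitness[where f' = "\<lambda>(p, q, r). (p, q / \<omega>, r / \<omega>\<^sup>2)"]) (use assms in auto)
  hence "card (hesse s) = card ?C"
    using bij_betw_same_card[OF bij_hesse[OF assms(1)]] by (simp add: bij_betw_same_card)
  moreover have "s \<noteq> 0" using assms by auto
  ultimately show ?thesis
    using card_prod_zero_plane[of "3 * s"] card_nonzero_sum[of "3 * s"] assms three_nz by simp
qed

text \<open>If u v is nonzero, exactly one s puts (u, v) on its cubic. If u v = 0, the parameter
  drops out, and either all Q values of s work or none; they work at the six points with one
  coordinate 0 and the other a cube root of -1.\<close>

lemma sum_card_hesse: "(\<Sum>s\<in>K. int (card (hesse s))) = (Q - 1)\<^sup>2 + 6 * Q"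
proof -
  have "(\<Sum>s\<in>K. int (card (hesse s))) =
      (\<Sum>s\<in>K. int (card {t \<in> K \<times> K. case t of (u, v) \<Rightarrow> u ^ 3 + v ^ 3 + 1 = 3 * s * u * v}))"
    by (intro sum.cong arg_cong[of _ _ "\<lambda>A. int (card A)"]) (auto simp: hesse_def)
  also have "\<dots> = (\<Sum>t\<in>K \<times> K. int (card {s \<in> K. case t of (u, v) \<Rightarrow> u ^ 3 + v ^ 3 + 1 = 3 * s * u * v}))"
    by (rule sum_card_swap) auto
  also have "\<dots> = (\<Sum>t\<in>K \<times> K. of_bool (t \<in> K0 \<times> K0)
      + Q * of_bool (t \<in> {0} \<times> {v \<in> K. v ^ 3 = -1} \<union> {v \<in> K. v ^ 3 = -1} \<times> {0}))"
  proof (intro sum.cong refl, clarify)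
    fix u v assume uv: "u \<in> K" "v \<in> K"
    show "int (card {s \<in> K. u ^ 3 + v ^ 3 + 1 = 3 * s * u * v}) = of_bool ((u, v) \<in> K0 \<times> K0)
      + Q * of_bool ((u, v) \<in> {0} \<times> {v \<in> K. v ^ 3 = -1} \<union> {v \<in> K. v ^ 3 = -1} \<times> {0})"
    proof (cases "u * v = 0")
      case True
      thus ?thesis using uv by (auto simp: add_eq_0_iff2)
    next
      case False
      have "{s \<in> K. u ^ 3 + v ^ 3 + 1 = 3 * s * u * v} = {s \<in> K. (3 * u * v) * s = u ^ 3 + v ^ 3 + 1}"
        by (auto simp: mult_ac)
      thus ?thesis using False uv three_nz card_linear[of "3 * u * v" "u ^ 3 + v ^ 3 + 1"] by simp
    qed
  qed
  also have "\<dots> = int (card {t \<in> K \<times> K. t \<in> K0 \<times> K0}) +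
      Q * int (card {t \<in> K \<times> K. t \<in> {0} \<times> {v \<in> K. v ^ 3 = -1} \<union> {v \<in> K. v ^ 3 = -1} \<times> {0}})"
    by (subst (1 2) card_as_sum) (simp_all add: sum.distrib sum_distrib_left)
  also have "{t \<in> K \<times> K. t \<in> K0 \<times> K0} = K0 \<times> K0"
    by auto
  also have "{t \<in> K \<times> K. t \<in> {0} \<times> {v \<in> K. v ^ 3 = -1} \<union> {v \<in> K. v ^ 3 = -1} \<times> {0}} =
      {0} \<times> {v \<in> K. v ^ 3 = -1} \<union> {v \<in> K. v ^ 3 = -1} \<times> {0}"
    by auto
  also have "card ({0} \<times> {v \<in> K. v ^ 3 = -1} \<union> {v \<in> K. v ^ 3 = -1} \<times> {0}) = 6"
    by (subst card_Un_disjoint) (auto simp: card_cartesian_product)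
  finally show ?thesis by (simp add: card_cartesian_product power2_eq_square)
qed

definition scaled_fibre :: "'a \<Rightarrow> 'a \<Rightarrow> ('a \<times> 'a \<times> 'a) set" where
  "scaled_fibre s x = {(l, m, k). l \<in> K \<and> m \<in> K \<and> k \<in> K \<and> l * m * k = s ^ 3 - 1 \<and>
     l * (1 + x) + m * (1 + \<omega> * x) + k * (1 + \<omega>\<^sup>2 * x) = 3 * s * x}"

lemma cube_plus_one: "(1 + x) * (1 + \<omega> * x) * (1 + \<omega>\<^sup>2 * x) = 1 + x ^ 3"
  using sum_three_cubes[of 1 x 0] by simp

text \<open>The three scaling factors multiply to 1 + x^3, so they are all invertible here. The gain
  of rescaling is that x survives only in one linear equation.\<close>

lemma card_fibre_generic:
  assumes "s \<in> K" "x \<in> K" "x ^ 3 \<noteq> -1"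
  shows "card (fibre s x) = card (scaled_fibre s x)"
proof -
  have "1 + x ^ 3 \<noteq> 0" using assms(3) by (simp add: add_eq_0_iff)
  hence nz: "1 + x \<noteq> 0" "1 + \<omega> * x \<noteq> 0" "1 + \<omega>\<^sup>2 * x \<noteq> 0"
    unfolding cube_plus_one[symmetric] by simp_all
  have *: "l * (1 + x) * (m * (1 + \<omega> * x)) * (k * (1 + \<omega>\<^sup>2 * x)) = l * m * k * (1 + x ^ 3)" for l m k
    unfolding cube_plus_one[symmetric] by (simp only: ac_simps)
  have **: "p / (1 + x) * (q / (1 + \<omega> * x)) * (r / (1 + \<omega>\<^sup>2 * x)) = p * q * r / (1 + x ^ 3)" for p q r
    unfolding cube_plus_one[symmetric] by simp
  have "bij_betw (\<lambda>(l, m, k). (l * (1 + x), m * (1 + \<omega> * x), k * (1 + \<omega>\<^sup>2 * x))) (scaled_fibre s x) (fibre s x)"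
    by (rule bij_betw_byWitness[where f' = "\<lambda>(p, q, r). (p / (1 + x), q / (1 + \<omega> * x), r / (1 + \<omega>\<^sup>2 * x))"])
      (use assms nz \<open>1 + x ^ 3 \<noteq> 0\<close> in \<open>auto simp: scaled_fibre_def fibre_def * ** cube_plus_one\<close>)
  thus ?thesis by (simp add: bij_betw_same_card)
qed

lemma card_weighted_sum:
  assumes "c \<in> K0" "g \<in> K0" "h \<in> K0" "e \<in> K"
  shows "card {(l, m, k). l \<in> K \<and> m \<in> K \<and> k \<in> K \<and> l * m * k = c \<and> m * g + k * h = e} =
    card {(m, k). m \<in> K0 \<and> k \<in> K0 \<and> m + k = e}"
proof -
  have "bij_betw (\<lambda>(l, m, k). (m * g, k * h))
    {(l, m, k). l \<in> K \<and> m \<in> K \<and> k \<in> K \<and> l * m * k = c \<and> m * g + k * h = e}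
    {(m, k). m \<in> K0 \<and> k \<in> K0 \<and> m + k = e}"
    \<comment> \<open>The first coordinate is forced by the product condition: it is c divided by (m
      / g)(k / h).\<close>
    by (rule bij_betw_byWitness[where f' = "\<lambda>(m, k). (c * g * h / (m * k), m / g, k / h)"])
      (use assms in \<open>auto simp: field_simps\<close>)
  thus ?thesis by (rule bij_betw_same_card)
qed

text \<open>Exactly one of the three scaling factors vanishes. In \<open>fibre\<close> the product
  condition becomes p q r = 0, giving three lines; in \<open>scaled_fibre\<close> one variable
  leaves the linear equation and is determined by the product of the other two. The two counts share
  their last term and differ by 2Q - 1.\<close>

lemma card_fibre_special:
  assumes "s \<in> K" "s ^ 3 \<noteq> 1" "x \<in> K" "x ^ 3 = -1"
  shows "int (card (fibre s x)) = 2 * Q - 1 + int (card (scaled_fibre s x))"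
proof -
  define e where "e = 3 * s * x"
  have c: "s ^ 3 - 1 \<in> K0" and e: "e \<in> K" using assms by (auto simp: e_def)
  have fib: "int (card (fibre s x)) = 2 * Q - 1 + int (card {(m, k). m \<in> K0 \<and> k \<in> K0 \<and> m + k = e})"
    unfolding card_prod_zero_plane[OF e, symmetric] using assms by (simp add: fibre_def e_def)
  have x: "x = -1 \<or> x = -\<omega> \<or> x = -\<omega>\<^sup>2"
    using assms cube_roots_of_minus_one by blast
  have w3: "\<omega> * \<omega>\<^sup>2 = 1" "\<omega>\<^sup>2 * \<omega> = 1" "\<omega>\<^sup>2 * \<omega>\<^sup>2 = \<omega>" "\<omega> * \<omega> = \<omega>\<^sup>2" "\<omega> ^ 4 = \<omega>"
    using omega_powers(1) by (simp_all add: power2_eq_square power3_eq_cube power4_eq_xxxx mult.assoc)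
  \<comment> \<open>The permutations bring the variable with vanishing coefficient to the first
    place, as \<open>card_weighted_sum\<close> requires; the other two coefficients are always 1 -
    \<omega> and 1 - \<omega>^2 in some order.\<close>
  have swap12: "card {(l, m, k). P l m k} = card {(l, m, k). P m l k}" for P :: "'a \<Rightarrow> 'a \<Rightarrow> 'a \<Rightarrow> bool"
    by (rule bij_betw_same_card[of "\<lambda>(l, m, k). (m, l, k)"], rule bij_betw_byWitness[where f' = "\<lambda>(l, m, k). (m, l, k)"]) auto
  have swap13: "card {(l, m, k). P l m k} = card {(l, m, k). P k m l}" for P :: "'a \<Rightarrow> 'a \<Rightarrow> 'a \<Rightarrow> bool"
    by (rule bij_betw_same_card[of "\<lambda>(l, m, k). (k, m, l)"], rule bij_betw_byWitness[where f' = "\<lambda>(l, m, k). (k, m, l)"]) auto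
  note w = card_weighted_sum[OF c _ _ e]
  have sc: "scaled_fibre s x = {(l, m, k). l \<in> K \<and> m \<in> K \<and> k \<in> K \<and> l * m * k = s ^ 3 - 1 \<and>
     l * (1 + x) + m * (1 + \<omega> * x) + k * (1 + \<omega>\<^sup>2 * x) = e}"
    by (simp add: scaled_fibre_def e_def)
  from x have "card (scaled_fibre s x) = card {(m, k). m \<in> K0 \<and> k \<in> K0 \<and> m + k = e}"
  proof (elim disjE)
    assume "x = -1"
    thus ?thesis unfolding sc w[of "1 - \<omega>" "1 - \<omega>\<^sup>2", symmetric]
      by (subst w[of "1 - \<omega>" "1 - \<omega>\<^sup>2", symmetric]) auto
  next
    assume "x = -\<omega>"
    thus ?thesis unfolding sc
      by (subst swap13, subst w[of "1 - \<omega>\<^sup>2" "1 - \<omega>", symmetric])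
        (auto simp: w3 intro!: arg_cong[of _ _ card] simp: ac_simps)
  next
    assume "x = -\<omega>\<^sup>2"
    thus ?thesis unfolding sc
      by (subst swap12, subst w[of "1 - \<omega>\<^sup>2" "1 - \<omega>", symmetric])
        (auto simp: w3 intro!: arg_cong[of _ _ card] simp: ac_simps)
  qed
  with fib show ?thesis by simp
qed

section \<open>Summation over the torus\<close>

definition torus :: "'a \<Rightarrow> ('a \<times> 'a \<times> 'a) set" where
  "torus c = {(l, m, k). l \<in> K \<and> m \<in> K \<and> k \<in> K \<and> l * m * k = c}"

lemma finite_torus [simp]: "finite (torus c)"
  unfolding torus_def by (rule finite_subset[of _ "K \<times> K \<times> K"]) auto

text \<open>After exchanging the sums, each point of the torus contributes one solution x, unless
  the coefficient of x vanishes; then it contributes Q or none. By \<open>bij_hesse\<close> these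
  exceptional points correspond to the Hesse cubic, and those contributing Q to its three points
  with u = 0.\<close>

lemma sum_card_scaled_fibre:
  assumes "s \<in> K" "s ^ 3 \<noteq> 1"
  shows "(\<Sum>x\<in>K. int (card (scaled_fibre s x))) = (Q - 1)\<^sup>2 - int (card (hesse s)) + 3 * Q"
proof -
  define T where "T = torus (s ^ 3 - 1)"
  \<comment> \<open>The linear condition of \<^term>\<open>scaled_fibre s x\<close> at \<open>t\<close> reads \<open>a t + (b t - 3 s) x = 0\<close>.\<close>
  define a where "a = (\<lambda>(l, m, k). l + m + k :: 'a)"
  define b where "b = (\<lambda>(l, m, k). l + \<omega> * m + \<omega>\<^sup>2 * k)"
  have "(\<Sum>x\<in>K. int (card (scaled_fibre s x))) = (\<Sum>x\<in>K. int (card {t \<in> T. a t + (b t - 3 * s) * x = 0}))"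
    by (intro sum.cong arg_cong[of _ _ "\<lambda>A. int (card A)"])
       (auto simp: scaled_fibre_def torus_def T_def a_def b_def algebra_simps)
  also have "\<dots> = (\<Sum>t\<in>T. int (card {x \<in> K. a t + (b t - 3 * s) * x = 0}))"
    by (rule sum_card_swap) (simp_all add: T_def)
  also have "\<dots> = (\<Sum>t\<in>T. 1 - of_bool (b t = 3 * s) + Q * of_bool (b t = 3 * s \<and> a t = 0))"
  proof (intro sum.cong refl)
    fix t assume t: "t \<in> T"
    hence K: "a t \<in> K" "b t \<in> K" by (auto simp: T_def torus_def a_def b_def)
    show "int (card {x \<in> K. a t + (b t - 3 * s) * x = 0}) = 1 - of_bool (b t = 3 * s) + Q * of_bool (b t = 3 * s \<and> a t = 0)"
    proof (cases "b t = 3 * s")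
      case False
      have "{x \<in> K. a t + (b t - 3 * s) * x = 0} = {x \<in> K. (b t - 3 * s) * x = - a t}"
        by (simp add: add_eq_0_iff)
      thus ?thesis using False K assms card_linear[of "b t - 3 * s" "- a t"] by simp
    qed (use assms in auto)
  qed
  also have "\<dots> = int (card T) - int (card {t \<in> T. b t = 3 * s}) + Q * int (card {t \<in> T. b t = 3 * s \<and> a t = 0})"
    by (subst (1 2) card_as_sum) (simp_all add: T_def sum.distrib sum_subtractf sum_distrib_left)
  also have "int (card T) = (Q - 1)\<^sup>2"
    using card_units_prod[of "s ^ 3 - 1"] assms by (simp add: T_def torus_def)
  also have "{t \<in> T. b t = 3 * s} =
    {(l, m, k). l \<in> K \<and> m \<in> K \<and> k \<in> K \<and> l * m * k = s ^ 3 - 1 \<and> l + \<omega> * m + \<omega>\<^sup>2 * k = 3 * s}" (is "_ = ?B")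
    by (auto simp: T_def torus_def b_def)
  also have "card ?B = card (hesse s)"
    using bij_betw_same_card[OF bij_hesse[OF assms(1)]] by simp
  \<comment> \<open>Under the transform the sum of the three coordinates is 3u.\<close>
  also have "card {t \<in> T. b t = 3 * s \<and> a t = 0} = card {p \<in> hesse s. fst p = 0}"
  proof -
    let ?f = "\<lambda>(u, v). (u + v + s, u + \<omega> * v + \<omega>\<^sup>2 * s, u + \<omega>\<^sup>2 * v + \<omega> * s)"
    have a: "a (?f p) = 3 * fst p" for p
      using fourier_inverse(1)[OF refl refl refl, of "fst p" "snd p" s] three_nz
      by (simp add: a_def eq_divide_eq case_prod_unfold mult.commute)
    have "{t \<in> T. b t = 3 * s \<and> a t = 0} = {t \<in> ?B. a t = 0}"
      by (auto simp: T_def torus_def b_def)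
    also have "\<dots> = {t \<in> ?f ` hesse s. a t = 0}"
      unfolding bij_betw_imp_surj_on[OF bij_hesse[OF assms(1)]] ..
    also have "\<dots> = ?f ` {p \<in> hesse s. a (?f p) = 0}"
      by blast
    also have "\<dots> = ?f ` {p \<in> hesse s. fst p = 0}"
      unfolding a by simp
    finally have eq: "{t \<in> T. b t = 3 * s \<and> a t = 0} = ?f ` {p \<in> hesse s. fst p = 0}" .
    show "card {t \<in> T. b t = 3 * s \<and> a t = 0} = card {p \<in> hesse s. fst p = 0}"
      unfolding eq
      by (rule card_image, rule inj_on_subset[OF bij_betw_imp_inj_on[OF bij_hesse[OF assms(1)]]]) auto
  qed
  also have "{p \<in> hesse s. fst p = 0} = {0} \<times> {v \<in> K. v ^ 3 = -1}"
    by (auto simp: hesse_def add_eq_0_iff2)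
  finally show ?thesis by (simp add: card_cartesian_product)
qed

text \<open>Each of the three x with x^3 = -1 adds 2Q - 1 to the sum of the rescaled counts. The
  Hesse cubic is carried along uncounted until the sum over s is taken.\<close>

lemma card_affine_cubics_smooth:
  assumes "s \<in> K" "s ^ 3 \<noteq> 1"
  shows "int (card (affine_cubics s)) + int (card (hesse s)) = Q\<^sup>2 + 7 * Q - 2"
proof -
  have "int (card (affine_cubics s)) = (\<Sum>x\<in>K. int (card (fibre s x)))"
    by (rule card_affine_cubics[OF assms(1)])
  also have "\<dots> = (\<Sum>x\<in>K. int (card (scaled_fibre s x)) + (2 * Q - 1) * of_bool (x ^ 3 = -1))"
    using card_fibre_generic[OF assms(1)] card_fibre_special[OF assms] by (intro sum.cong refl) auto
  also have "\<dots> = (\<Sum>x\<in>K. int (card (scaled_fibre s x))) + (2 * Q - 1) * int (card {x \<in> K. x ^ 3 = -1})"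
    by (subst card_as_sum) (simp_all add: sum.distrib sum_distrib_left)
  finally show ?thesis
    unfolding sum_card_scaled_fibre[OF assms] by (simp add: algebra_simps power2_eq_square)
qed

text \<open>The product condition becomes p q r = 0, while p + q + r = 3 s x merely determines x. So
  the surface is in bijection with a union of three planes.\<close>

lemma card_affine_cubics_degenerate:
  assumes "s \<in> K" "s ^ 3 = 1"
  shows "int (card (affine_cubics s)) = 3 * Q\<^sup>2 - 3 * Q + 1"
proof -
  let ?B = "{(p, q, r). p \<in> K \<and> q \<in> K \<and> r \<in> K \<and> p * q * r = 0}"
  have "s \<noteq> 0" using assms by auto
  hence "bij_betw snd (SIGMA x:K. fibre s x) ?B"
    by (intro bij_betw_byWitness[where f' = "\<lambda>(p, q, r). ((p + q + r) / (3 * s), p, q, r)"])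
      (use assms three_nz in \<open>auto simp: fibre_def\<close>)
  hence "card (SIGMA x:K. fibre s x) = card ?B"
    by (rule bij_betw_same_card)
  moreover have "int (card (SIGMA x:K. fibre s x)) = (\<Sum>x\<in>K. int (card (fibre s x)))"
    by (rule card_Sigma_K) simp_all
  ultimately show ?thesis
    using card_affine_cubics[OF assms(1)] card_prod_zero3 by (simp only:)
qed

lemma sum_card_affine_cubics_omega:
  "(\<Sum>s\<in>K. int (card (affine_cubics s))) = Q ^ 3 + 12 * Q\<^sup>2 - 27 * Q - 1"
proof -
  \<comment> \<open>For s^3 = 1 the two counts add up to 3Q^2 - 2, which exceeds the generic value
    by 2Q^2 - 7Q.\<close>
  have "(\<Sum>s\<in>K. int (card (affine_cubics s))) + (\<Sum>s\<in>K. int (card (hesse s))) =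
    (\<Sum>s\<in>K. Q\<^sup>2 + 7 * Q - 2 + (2 * Q\<^sup>2 - 7 * Q) * of_bool (s ^ 3 = 1))"
    unfolding sum.distrib[symmetric]
  proof (intro sum.cong refl)
    fix s assume s: "s \<in> K"
    show "int (card (affine_cubics s)) + int (card (hesse s)) =
        Q\<^sup>2 + 7 * Q - 2 + (2 * Q\<^sup>2 - 7 * Q) * of_bool (s ^ 3 = 1)"
    proof (cases "s ^ 3 = 1")
      case True
      show ?thesis
        unfolding card_affine_cubics_degenerate[OF s True] card_hesse_degenerate[OF s True] using True by simp
    qed (use card_affine_cubics_smooth[OF s] in simp)
  qed
  also have "\<dots> = Q * (Q\<^sup>2 + 7 * Q - 2) + (2 * Q\<^sup>2 - 7 * Q) * int (card {s \<in> K. s ^ 3 = 1})"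
    by (subst card_as_sum) (simp_all add: sum.distrib sum_distrib_left sum_distrib_right)
  also have "int (card {s \<in> K. s ^ 3 = 1}) = 3"
    by simp
  finally show ?thesis
    unfolding sum_card_hesse by (simp add: algebra_simps power2_eq_square power3_eq_cube)
qed

end

section \<open>Fields on which cubing is injective\<close>

text \<open>Injectivity is asked on K only: the algebraic closure, in which the locale is used, has
  three cube roots of unity.\<close>

locale finite_subfield_cube_inj = finite_subfield +
  assumes cube_inj: "inj_on (\<lambda>x. x ^ 3) K"
begin

lemma cube_eq_imp_eq: "x \<in> K \<Longrightarrow> y \<in> K \<Longrightarrow> x ^ 3 = y ^ 3 \<Longrightarrow> x = y"
  using cube_inj by (auto dest: inj_onD)

lemma sum_two_cubes_eq_0:
  assumes "x \<in> K" "y \<in> K"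
  shows "x ^ 3 + y ^ 3 = 0 \<longleftrightarrow> x = - y"
  using assms cube_eq_imp_eq[of x "- y"] by (auto simp: add_eq_0_iff2)

lemma cube_surj:
  assumes "d \<in> K"
  obtains t where "t \<in> K" "t ^ 3 = d"
proof -
  have "(\<lambda>x. x ^ 3) ` K = K"
    using cube_inj by (intro endo_inj_surj) auto
  thus ?thesis using assms that by (metis (no_types, lifting) imageE)
qed

definition cubic_cone :: "'a \<Rightarrow> ('a \<times> 'a \<times> 'a) set" where
  "cubic_cone s = {(x, y, z). x \<in> K \<and> y \<in> K \<and> z \<in> K \<and> x ^ 3 + y ^ 3 + z ^ 3 - 3 * s * x * y * z = 0}"

text \<open>Scaling by t multiplies the cubic form by t^3, which runs once through the nonzero
  elements of K. Since s^3 - 1 is nonzero, the vectors off the cone are the Q - 1 disjoint scalings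
  of the affine surface.\<close>

lemma card_affine_cubics_generic:
  assumes "s \<in> K" "s \<noteq> 1"
  shows "(Q - 1) * int (card (affine_cubics s)) = Q ^ 3 - int (card (cubic_cone s))"
proof -
  define f where "f = (\<lambda>(x, y, z). x ^ 3 + y ^ 3 + z ^ 3 - 3 * s * x * y * z)"
  define scale where "scale = (\<lambda>(t :: 'a, x, y, z). (t * x, t * y, t * z))"
  have f_scale: "f (scale (t, v)) = t ^ 3 * f v" for t v
    by (cases v) (simp add: f_def scale_def algebra_simps power3_eq_cube)
  have aff: "affine_cubics s = {v \<in> K \<times> K \<times> K. f v = s ^ 3 - 1}"
    and cone: "K \<times> K \<times> K - cubic_cone s = {v \<in> K \<times> K \<times> K. f v \<noteq> 0}"
    by (auto simp: affine_cubics_def cubic_cone_def f_def)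
  have c: "s ^ 3 - 1 \<noteq> 0"
    using assms cube_eq_imp_eq[of s 1] by auto
  have "bij_betw scale (K0 \<times> affine_cubics s) (K \<times> K \<times> K - cubic_cone s)"
    unfolding bij_betw_def
  proof
    show "inj_on scale (K0 \<times> affine_cubics s)"
    proof (rule inj_onI)
      fix a b assume ab: "a \<in> K0 \<times> affine_cubics s" "b \<in> K0 \<times> affine_cubics s" "scale a = scale b"
      obtain t v t' v' where *: "a = (t, v)" "b = (t', v')" by (cases a, cases b)
      have "t ^ 3 * f v = t' ^ 3 * f v'"
        using ab(3) unfolding * f_scale[symmetric] by simp
      hence "t ^ 3 = t' ^ 3"
        using ab c unfolding * by (simp add: aff)
      hence "t = t'"
        using ab unfolding * by (auto intro: cube_eq_imp_eq)
      thus "a = b"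
        using ab unfolding * scale_def by (auto split: prod.splits)
    qed
    show "scale ` (K0 \<times> affine_cubics s) = K \<times> K \<times> K - cubic_cone s"
    proof
      show "scale ` (K0 \<times> affine_cubics s) \<subseteq> K \<times> K \<times> K - cubic_cone s"
        unfolding cone using c by (auto simp: f_scale) (auto simp: aff scale_def)
      show "K \<times> K \<times> K - cubic_cone s \<subseteq> scale ` (K0 \<times> affine_cubics s)"
      proof
        fix v assume v: "v \<in> K \<times> K \<times> K - cubic_cone s"
        hence fv: "f v \<noteq> 0" "f v \<in> K" unfolding cone by (auto simp: f_def assms)
        \<comment> \<open>The cube root of the ratio of the two values is the scalar that leads back
          to the value s^3 - 1.\<close>
        then obtain t where t: "t \<in> K" "t ^ 3 = f v / (s ^ 3 - 1)"
          using cube_surj[of "f v / (s ^ 3 - 1)"] assms by auto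
        hence "t \<noteq> 0" using fv c by auto
        define w where "w = scale (1 / t, v)"
        have "f w = s ^ 3 - 1"
          unfolding w_def f_scale using t(2) fv c by (simp add: power_one_over)
        moreover have "w \<in> K \<times> K \<times> K" "scale (t, w) = v"
          using v t \<open>t \<noteq> 0\<close> by (auto simp: w_def scale_def)
        ultimately show "v \<in> scale ` (K0 \<times> affine_cubics s)"
          using t \<open>t \<noteq> 0\<close> unfolding aff by (intro image_eqI[of _ _ "(t, w)"]) auto
      qed
    qed
  qed
  hence "int (card (K0 \<times> affine_cubics s)) = int (card (K \<times> K \<times> K - cubic_cone s))"
    by (simp only: bij_betw_same_card)
  also have "\<dots> = int (card (K \<times> K \<times> K)) - int (card (cubic_cone s))"
    by (rule int_card_Diff) (auto simp: cubic_cone_def)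
  finally show ?thesis by (simp add: card_cartesian_product power3_eq_cube)
qed

text \<open>At s = 1 the form is x + y + z times a quadratic form in x - z and y - z. The latter has
  no nontrivial zero over K, because u^3 + v^3 = 0 forces u = -v and then 3v^2 = 0. What is left is
  a plane and the diagonal, which meet only in the origin.\<close>

lemma card_cubic_cone_1: "int (card (cubic_cone 1)) = Q\<^sup>2 + Q - 1"
proof -
  have "cubic_cone 1 = (\<lambda>(x, y). (x, y, - x - y)) ` (K \<times> K) \<union> (\<lambda>t. (t, t, t)) ` K0" (is "_ = ?A \<union> ?B")
  proof (rule Set.set_eqI)
    fix t :: "'a \<times> 'a \<times> 'a"
    obtain x y z where t: "t = (x, y, z)" by (cases t)
    have factor: "x ^ 3 + y ^ 3 + z ^ 3 - 3 * x * y * z =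
        (x + y + z) * ((x - z)\<^sup>2 - (x - z) * (y - z) + (y - z)\<^sup>2)"
      by (simp add: algebra_simps power2_eq_square power3_eq_cube)
    have quad: "u\<^sup>2 - u * v + v\<^sup>2 = 0 \<longleftrightarrow> u = 0 \<and> v = 0" if "u \<in> K" "v \<in> K" for u v
    proof
      assume *: "u\<^sup>2 - u * v + v\<^sup>2 = 0"
      have "u ^ 3 + v ^ 3 = (u + v) * (u\<^sup>2 - u * v + v\<^sup>2)"
        by (simp add: algebra_simps power2_eq_square power3_eq_cube)
      hence u: "u = - v" using sum_two_cubes_eq_0[OF that] * by simp
      with * have "3 * v\<^sup>2 = 0" by (simp add: power2_eq_square)
      thus "u = 0 \<and> v = 0" using u three_nz by simp
    qed simp
    have "(x, y, z) \<in> cubic_cone 1 \<longleftrightarrow> (x, y, z) \<in> ?A \<union> ?B"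
    proof (cases "x \<in> K \<and> y \<in> K \<and> z \<in> K")
      case True
      hence "x ^ 3 + y ^ 3 + z ^ 3 - 3 * x * y * z = 0 \<longleftrightarrow> x + y + z = 0 \<or> x = z \<and> y = z"
        unfolding factor using quad[of "x - z" "y - z"] by simp
      hence "(x, y, z) \<in> cubic_cone 1 \<longleftrightarrow> x + y + z = 0 \<or> x = z \<and> y = z"
        using True by (simp add: cubic_cone_def)
      also have "\<dots> \<longleftrightarrow> (x, y, z) \<in> ?A \<union> ?B"
        using True by (auto simp: image_iff algebra_simps eq_neg_iff_add_eq_0)
      finally show ?thesis .
    qed (auto simp: cubic_cone_def)
    thus "t \<in> cubic_cone 1 \<longleftrightarrow> t \<in> ?A \<union> ?B"
      unfolding t .
  qed
  moreover have "?A \<inter> ?B = {}"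
  proof -
    have False if "t \<noteq> 0" "t = - t - t" for t :: 'a
    proof -
      have "3 * t = 0" using that(2) by (simp add: algebra_simps eq_neg_iff_add_eq_0)
      thus False using that three_nz by simp
    qed
    thus ?thesis by auto
  qed
  moreover have "card ?A = card (K \<times> K)"
    by (rule card_image) (auto intro!: inj_onI)
  moreover have "card ?B = card K0"
    by (rule card_image) (rule inj_onI, simp)
  ultimately have "card (cubic_cone 1) = card (K \<times> K) + card K0"
    by (simp add: card_Un_disjoint del: card_cartesian_product)
  thus ?thesis by (simp add: card_cartesian_product power2_eq_square)
qed

text \<open>Triples of nonzero coordinates lie on the cone for exactly one s. If a coordinate is 0,
  then s drops out, and the triple counts Q times or not at all.\<close>

lemma sum_card_cubic_cone: "(\<Sum>s\<in>K. int (card (cubic_cone s))) = (Q - 1) ^ 3 + Q * (3 * Q - 2)"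
proof -
  let ?Z = "{(x, y, z). x \<in> K \<and> y \<in> K \<and> z \<in> K \<and> x * y * z = 0 \<and> x ^ 3 + y ^ 3 + z ^ 3 = 0}"
  have "(\<Sum>s\<in>K. int (card (cubic_cone s))) =
      (\<Sum>s\<in>K. int (card {t \<in> K \<times> K \<times> K. case t of (x, y, z) \<Rightarrow> x ^ 3 + y ^ 3 + z ^ 3 = 3 * s * x * y * z}))"
    by (intro sum.cong arg_cong[of _ _ "\<lambda>A. int (card A)"]) (auto simp: cubic_cone_def)
  also have "\<dots> = (\<Sum>t\<in>K \<times> K \<times> K. int (card {s \<in> K. case t of (x, y, z) \<Rightarrow> x ^ 3 + y ^ 3 + z ^ 3 = 3 * s * x * y * z}))"
    by (rule sum_card_swap) auto
  also have "\<dots> = (\<Sum>t\<in>K \<times> K \<times> K. of_bool (t \<in> K0 \<times> K0 \<times> K0) + Q * of_bool (t \<in> ?Z))"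
  proof (intro sum.cong refl, clarify)
    fix x y z assume xyz: "x \<in> K" "y \<in> K" "z \<in> K"
    show "int (card {s \<in> K. x ^ 3 + y ^ 3 + z ^ 3 = 3 * s * x * y * z}) =
        of_bool ((x, y, z) \<in> K0 \<times> K0 \<times> K0) + Q * of_bool ((x, y, z) \<in> ?Z)"
    proof (cases "x * y * z = 0")
      case True
      thus ?thesis using xyz by auto
    next
      case False
      have "{s \<in> K. x ^ 3 + y ^ 3 + z ^ 3 = 3 * s * x * y * z} = {s \<in> K. (3 * x * y * z) * s = x ^ 3 + y ^ 3 + z ^ 3}"
        by (auto simp: mult_ac)
      thus ?thesis using False xyz three_nz card_linear[of "3 * x * y * z" "x ^ 3 + y ^ 3 + z ^ 3"] by simp
    qed
  qed
  also have "\<dots> = int (card {t \<in> K \<times> K \<times> K. t \<in> K0 \<times> K0 \<times> K0}) + Q * int (card {t \<in> K \<times> K \<times> K. t \<in> ?Z})"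
    by (subst (1 2) card_as_sum) (simp_all add: sum.distrib sum_distrib_left)
  also have "{t \<in> K \<times> K \<times> K. t \<in> K0 \<times> K0 \<times> K0} = K0 \<times> K0 \<times> K0"
    by auto
  \<comment> \<open>With one coordinate 0, the other two are opposite by injectivity of cubing.
    These are three lines through the origin, which is counted on the first one only.\<close>
  also have "{t \<in> K \<times> K \<times> K. t \<in> ?Z} =
    (\<lambda>y. (0, - y, y)) ` K \<union> ((\<lambda>x. (- x, 0, x)) ` K0 \<union> (\<lambda>x. (- x, x, 0)) ` K0)" (is "_ = ?A \<union> (?B \<union> ?C)")
  proof (rule Set.set_eqI)
    fix t :: "'a \<times> 'a \<times> 'a"
    obtain x y z where t: "t = (x, y, z)" by (cases t)
    show "t \<in> {t \<in> K \<times> K \<times> K. t \<in> ?Z} \<longleftrightarrow> t \<in> ?A \<union> (?B \<union> ?C)"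
      unfolding t using sum_two_cubes_eq_0[of x y] sum_two_cubes_eq_0[of x z] sum_two_cubes_eq_0[of y z]
      by (auto simp: image_iff)
  qed
  also have "card (?A \<union> (?B \<union> ?C)) = card K + (card K0 + card K0)"
  proof -
    have "card ?A = card K" "card ?B = card K0" "card ?C = card K0"
      by (rule card_image, rule inj_onI, simp)+
    moreover have "?A \<inter> (?B \<union> ?C) = {}" "?B \<inter> ?C = {}" by auto
    ultimately show ?thesis by (simp add: card_Un_disjoint)
  qed
  also have "int (card (K0 \<times> K0 \<times> K0)) = (Q - 1) ^ 3"
    by (simp add: card_cartesian_product power3_eq_cube)
  finally show ?thesis by simp
qed

lemma sum_card_affine_cubics_cube_inj:
  "(\<Sum>s\<in>K. int (card (affine_cubics s))) = Q ^ 3 + Q - 1"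
proof -
  \<comment> \<open>At s = 1 the affine surface is itself the cone. With N for the size of that
    cone, the left side is (Q - 1) N instead of Q^3 - N, hence the correction Q N - Q^3.\<close>
  have "(Q - 1) * (\<Sum>s\<in>K. int (card (affine_cubics s))) =
    (\<Sum>s\<in>K. Q ^ 3 - int (card (cubic_cone s)) + (Q * (Q\<^sup>2 + Q - 1) - Q ^ 3) * of_bool (s = 1))"
    unfolding sum_distrib_left
  proof (intro sum.cong refl)
    fix s assume s: "s \<in> K"
    show "(Q - 1) * int (card (affine_cubics s)) =
      Q ^ 3 - int (card (cubic_cone s)) + (Q * (Q\<^sup>2 + Q - 1) - Q ^ 3) * of_bool (s = 1)"
    proof (cases "s = 1")
      case True
      have "affine_cubics 1 = cubic_cone 1" by (simp add: affine_cubics_def cubic_cone_def)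
      thus ?thesis unfolding True by (simp add: card_cubic_cone_1 algebra_simps)
    qed (use card_affine_cubics_generic[OF s] in simp)
  qed
  also have "\<dots> = Q * Q ^ 3 - (\<Sum>s\<in>K. int (card (cubic_cone s))) + (Q * (Q\<^sup>2 + Q - 1) - Q ^ 3)"
    by (simp add: sum.distrib sum_subtractf sum_distrib_left[symmetric] of_bool_def)
  also have "\<dots> = (Q - 1) * (Q ^ 3 + Q - 1)"
    unfolding sum_card_cubic_cone by (simp add: algebra_simps power2_eq_square power3_eq_cube)
  finally show ?thesis using card_K_ge_2 by simp
qed

end

section \<open>From affine to projective points\<close>

lemma UNIV_5: "(UNIV :: 5 set) = {0, 1, 2, 3, 4}"
proof -
  have "card {0, 1, 2, 3, 4 :: 5} = CARD(5)" by simp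
  thus ?thesis by (intro card_eq_UNIV_imp_eq_UNIV[symmetric]) auto
qed

lemma all_5: "(\<forall>i :: 5. P i) \<longleftrightarrow> P 0 \<and> P 1 \<and> P 2 \<and> P 3 \<and> P 4"
proof -
  have "(\<forall>i :: 5. P i) \<longleftrightarrow> (\<forall>i \<in> {0, 1, 2, 3, 4 :: 5}. P i)"
    unfolding UNIV_5[symmetric] by simp
  thus ?thesis by simp
qed

definition vec5 :: "'a :: zero \<Rightarrow> 'a \<Rightarrow> 'a \<Rightarrow> 'a \<Rightarrow> 'a \<Rightarrow> 'a ^ 5" where
  "vec5 a x y z b = (\<chi> i. if i = 0 then a else if i = 1 then x else if i = 2 then y else if i = 3 then z else b)"

lemma vec5_nth [simp]:
  "vec5 a x y z b $ 0 = a" "vec5 a x y z b $ 1 = x" "vec5 a x y z b $ 2 = y"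
  "vec5 a x y z b $ 3 = z" "vec5 a x y z b $ 4 = b"
  by (simp_all add: vec5_def)

lemma vec5_eqI:
  "v $ 0 = a \<Longrightarrow> v $ 1 = x \<Longrightarrow> v $ 2 = y \<Longrightarrow> v $ 3 = z \<Longrightarrow> v $ 4 = b \<Longrightarrow> v = vec5 a x y z b"
  by (simp add: vec_eq_iff all_5)

lemma vec5_inject [simp]:
  "vec5 a x y z b = vec5 a' x' y' z' b' \<longleftrightarrow> a = a' \<and> x = x' \<and> y = y' \<and> z = z' \<and> b = b'"
  by (auto simp: vec_eq_iff all_5)

lemma proj_point_eq_iff: "proj_point y = proj_point y' \<longleftrightarrow> (\<exists>c. c \<noteq> 0 \<and> y = c *s y')"
proof
  assume "proj_point y = proj_point y'"
  moreover have "y \<in> proj_point y" unfolding proj_point_def by (auto intro!: exI[of _ 1])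
  ultimately show "\<exists>c. c \<noteq> 0 \<and> y = c *s y'" unfolding proj_point_def by auto
next
  assume "\<exists>c. c \<noteq> 0 \<and> y = c *s y'"
  then obtain c where c: "c \<noteq> 0" "y = c *s y'" by blast
  show "proj_point y = proj_point y'"
    unfolding proj_point_def
  proof (intro Set.set_eqI iffI)
    fix v assume "v \<in> {d *s y | d. d \<noteq> 0}"
    then obtain d where "d \<noteq> 0" "v = d *s y" by blast
    hence "v = (d * c) *s y'" "d * c \<noteq> 0" using c by (simp_all add: vector_smult_assoc)
    thus "v \<in> {d *s y' | d. d \<noteq> 0}" by blast
  next
    fix v assume "v \<in> {d *s y' | d. d \<noteq> 0}"
    then obtain d where "d \<noteq> 0" "v = d *s y'" by blast
    hence "v = (d / c) *s y" "d / c \<noteq> 0" using c by (simp_all add: vector_smult_assoc)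
    thus "v \<in> {d *s y | d. d \<noteq> 0}" by blast
  qed
qed

lemma burkhardt_form_scale: "burkhardt_form (c *s y) = c ^ 4 * burkhardt_form y"
  by (simp add: burkhardt_form_def algebra_simps power3_eq_cube power4_eq_xxxx)

context finite_subfield
begin

definition quartic_cone :: "('a ^ 5) set" where
  "quartic_cone = {y. (\<forall>i. y $ i \<in> K) \<and> burkhardt_form y = 0}"

text \<open>The hyperplane section y0 = 0 is the complement of the vectors with four nonzero
  coordinates. Off it, dividing by y0 leads to the affine chart, and each of the Q - 1 values of y0
  gives the same number.\<close>

lemma card_quartic_cone:
  "finite quartic_cone"
  "int (card quartic_cone) = Q ^ 4 - (Q - 1) ^ 4 + (Q - 1) * (\<Sum>s\<in>K. int (card (affine_cubics s)))"
proof -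
  let ?f = "\<lambda>(x, y, z, b). vec5 0 x y z b"
  \<comment> \<open>The sign of the last coordinate turns its cube into -s^3 and the quartic product
    into -3 s x y z, as in \<open>affine_cubics\<close>.\<close>
  let ?g = "\<lambda>(a, s, x, y, z). vec5 a (a * x) (a * y) (a * z) (- (a * s))"
  let ?A = "K \<times> K \<times> K \<times> K - K0 \<times> K0 \<times> K0 \<times> K0"
  let ?B = "K0 \<times> (SIGMA s:K. affine_cubics s)"
  have form: "burkhardt_form (vec5 a (a * x) (a * y) (a * z) (- (a * s))) =
      a ^ 4 * ((x ^ 3 + y ^ 3 + z ^ 3 - 3 * s * x * y * z) - (s ^ 3 - 1))" for a x y z s
    by (simp add: burkhardt_form_def algebra_simps power3_eq_cube power4_eq_xxxx)
  have form0: "burkhardt_form (vec5 0 x y z b) = 3 * x * y * z * b" for x y z b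
    by (simp add: burkhardt_form_def)
  have eq: "quartic_cone = ?f ` ?A \<union> ?g ` ?B"
  proof
    show "quartic_cone \<subseteq> ?f ` ?A \<union> ?g ` ?B"
    proof
      fix v assume "v \<in> quartic_cone"
      hence v: "v $ 0 \<in> K" "v $ 1 \<in> K" "v $ 2 \<in> K" "v $ 3 \<in> K" "v $ 4 \<in> K" "burkhardt_form v = 0"
        by (auto simp: quartic_cone_def)
      show "v \<in> ?f ` ?A \<union> ?g ` ?B"
      proof (cases "v $ 0 = 0")
        case True
        hence *: "v = vec5 0 (v $ 1) (v $ 2) (v $ 3) (v $ 4)"
          by (intro vec5_eqI) simp_all
        have "3 * v $ 1 * v $ 2 * v $ 3 * v $ 4 = 0"
          using v(6) form0 * by metis
        hence "(v $ 1, v $ 2, v $ 3, v $ 4) \<in> ?A" using v three_nz by auto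
        moreover have "v = ?f (v $ 1, v $ 2, v $ 3, v $ 4)" using * by simp
        ultimately show ?thesis by blast
      next
        case False
        define a x y z s where "a = v $ 0" and "x = v $ 1 / a" and "y = v $ 2 / a"
          and "z = v $ 3 / a" and "s = - v $ 4 / a"
        note defs = this
        have a: "a \<in> K0" "x \<in> K" "y \<in> K" "z \<in> K" "s \<in> K" using v False by (simp_all add: defs)
        have *: "v = ?g (a, s, x, y, z)"
          using False unfolding prod.case by (intro vec5_eqI) (simp_all add: defs)
        have "(x, y, z) \<in> affine_cubics s"
          using v(6) a unfolding * by (simp add: form affine_cubics_def)
        hence "(a, s, x, y, z) \<in> ?B" using a by simp
        with * show ?thesis by blast
      qed
    qed
    show "?f ` ?A \<union> ?g ` ?B \<subseteq> quartic_cone"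
      by (auto simp: quartic_cone_def all_5 form form0 affine_cubics_def)
  qed
  have fin_aff: "finite (affine_cubics s)" for s
    unfolding affine_cubics_def by (rule finite_subset[of _ "K \<times> K \<times> K"]) auto
  have fin: "finite (?f ` ?A)" "finite (?g ` ?B)"
    by (auto intro!: finite_imageI finite_cartesian_product finite_SigmaI fin_aff)
  thus "finite quartic_cone" unfolding eq by simp
  have "?f ` ?A \<inter> ?g ` ?B = {}" by auto
  with fin have "int (card quartic_cone) = int (card (?f ` ?A)) + int (card (?g ` ?B))"
    unfolding eq by (simp only: card_Un_disjoint of_nat_add)
  also have "card (?f ` ?A) = card ?A"
    by (rule card_image) (auto intro!: inj_onI)
  also have "card (?g ` ?B) = card ?B"
    by (rule card_image) (auto intro!: inj_onI)
  also have "int (card ?A) = int (card (K \<times> K \<times> K \<times> K)) - int (card (K0 \<times> K0 \<times> K0 \<times> K0))"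
    by (rule int_card_Diff) auto
  also have "\<dots> = Q ^ 4 - (Q - 1) ^ 4"
    by (simp add: card_cartesian_product power4_eq_xxxx)
  also have "int (card ?B) = (Q - 1) * (\<Sum>s\<in>K. int (card (affine_cubics s)))"
    using fin_aff by (simp add: card_cartesian_product)
  finally show "int (card quartic_cone) = Q ^ 4 - (Q - 1) ^ 4 + (Q - 1) * (\<Sum>s\<in>K. int (card (affine_cubics s)))" .
qed

text \<open>Every rational point is represented by exactly Q - 1 nonzero vectors of the cone over K;
  the subtracted 1 is the zero vector.\<close>

lemma card_rational_points_burkhardt:
  "(Q - 1) * int (card {P \<in> burkhardt_quartic. \<exists>y \<in> P. \<forall>i. y $ i \<in> K}) = int (card quartic_cone) - 1"
proof -
  let ?C = "quartic_cone - {0}"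
  have points: "{P \<in> burkhardt_quartic. \<exists>y \<in> P. \<forall>i. y $ i \<in> K} = proj_point ` ?C"
  proof (intro Set.set_eqI iffI)
    fix P assume "P \<in> {P \<in> burkhardt_quartic. \<exists>y \<in> P. \<forall>i. y $ i \<in> K}"
    then obtain y where P: "P \<in> proj_space" "y \<in> P" "\<forall>i. y $ i \<in> K" "burkhardt_form y = 0"
      by (auto simp: burkhardt_quartic_def)
    then obtain w c where w: "P = proj_point w" "w \<noteq> 0" "y = c *s w" "c \<noteq> 0"
      by (auto simp: proj_space_def proj_point_def)
    hence "y \<noteq> 0" by (simp add: vec_eq_iff)
    moreover have "P = proj_point y" using w proj_point_eq_iff by metis
    ultimately show "P \<in> proj_point ` ?C" using P by (auto simp: quartic_cone_def)
  next
    fix P assume "P \<in> proj_point ` ?C"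
    then obtain y where y: "P = proj_point y" "y \<in> quartic_cone" "y \<noteq> 0" by auto
    hence "P \<in> burkhardt_quartic"
      by (auto simp: burkhardt_quartic_def proj_space_def quartic_cone_def proj_point_def burkhardt_form_scale)
    moreover have "y \<in> P" unfolding y proj_point_def by (auto intro!: exI[of _ 1])
    ultimately show "P \<in> {P \<in> burkhardt_quartic. \<exists>y \<in> P. \<forall>i. y $ i \<in> K}"
      using y(2) by (auto simp: quartic_cone_def)
  qed
  have fin: "finite ?C" using card_quartic_cone(1) by simp
  have fibre: "int (card {y \<in> ?C. proj_point y = P}) = Q - 1" if P: "P \<in> proj_point ` ?C" for P
  proof -
    obtain y where y: "P = proj_point y" "y \<in> quartic_cone" "y \<noteq> 0" using P by auto
    then obtain i where i: "y $ i \<noteq> 0" by (auto simp: vec_eq_iff)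
    have "{y' \<in> ?C. proj_point y' = P} = (\<lambda>c. c *s y) ` K0"
    proof (intro Set.set_eqI iffI)
      fix y' assume "y' \<in> {y' \<in> ?C. proj_point y' = P}"
      then obtain c where c: "c \<noteq> 0" "y' = c *s y" "y' \<in> quartic_cone"
        by (auto simp: y(1) proj_point_eq_iff)
      \<comment> \<open>The scalar comes from the ambient field; being a ratio of coordinates of two
        vectors over K, it lies in K.\<close>
      hence "c = y' $ i / y $ i" using i by simp
      hence "c \<in> K" using c(3) y(2) by (simp add: quartic_cone_def)
      thus "y' \<in> (\<lambda>c. c *s y) ` K0" using c by auto
    next
      fix y' assume "y' \<in> (\<lambda>c. c *s y) ` K0"
      then obtain c where c: "c \<in> K0" "y' = c *s y" by auto
      thus "y' \<in> {y' \<in> ?C. proj_point y' = P}"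
        using y i by (auto simp: proj_point_eq_iff quartic_cone_def burkhardt_form_scale)
    qed
    moreover have "inj_on (\<lambda>c. c *s y) K0"
      using i by (auto intro!: inj_onI simp: vec_eq_iff)
    ultimately show ?thesis by (simp add: card_image)
  qed
  have "int (card ?C) = (\<Sum>P\<in>proj_point ` ?C. int (card {y \<in> ?C. proj_point y = P}))"
    using sum.image_gen[OF fin, of "\<lambda>_. 1 :: int" proj_point] by simp
  also have "\<dots> = (\<Sum>P\<in>proj_point ` ?C. Q - 1)"
    by (rule sum.cong[OF refl fibre])
  also have "\<dots> = (Q - 1) * int (card (proj_point ` ?C))"
    by simp
  finally have "int (card ?C) = (Q - 1) * int (card (proj_point ` ?C))" .
  moreover have "int (card ?C) = int (card quartic_cone) - int (card {0 :: 'a ^ 5})"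
    by (rule int_card_Diff, rule card_quartic_cone(1)) (simp add: quartic_cone_def burkhardt_form_def)
  ultimately show ?thesis unfolding points by simp
qed

lemma card_rational_points_affine:
  "int (card {P \<in> burkhardt_quartic. \<exists>y \<in> P. \<forall>i. y $ i \<in> K}) =
    4 * Q\<^sup>2 - 2 * Q + 2 + (\<Sum>s\<in>K. int (card (affine_cubics s)))" (is "?R = _ + ?A")
proof -
  have "(Q - 1) * ?R = Q ^ 4 - (Q - 1) ^ 4 + (Q - 1) * ?A - 1"
    unfolding card_rational_points_burkhardt card_quartic_cone(2) ..
  also have "\<dots> = (Q - 1) * (4 * Q\<^sup>2 - 2 * Q + 2 + ?A)"
    by (simp add: algebra_simps power2_eq_square power3_eq_cube power4_eq_xxxx)
  finally show ?thesis using card_K_ge_2 by simp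
qed

end

section \<open>The zeta function\<close>

lemma fps_exp_compose_deriv:
  fixes f :: "'a :: field_char_0 fps"
  assumes "fps_nth f 0 = 0"
  shows "fps_deriv (fps_exp 1 oo f) = (fps_exp 1 oo f) * fps_deriv f"
  using assms by (simp add: fps_compose_deriv)

text \<open>The product of the exponentials of f + g, -f and -g has derivative 0 and constant
  coefficient 1, so it is 1; the last two factors are then inverted by the same argument.\<close>

lemma fps_exp_compose_add:
  fixes f g :: "'a :: field_char_0 fps"
  assumes "fps_nth f 0 = 0" "fps_nth g 0 = 0"
  shows "fps_exp 1 oo (f + g) = (fps_exp 1 oo f) * (fps_exp 1 oo g)"
proof -
  let ?E = "\<lambda>f :: 'a fps. fps_exp 1 oo f"
  have const: "F = 1" if "fps_deriv F = 0" "fps_nth F 0 = 1" for F :: "'a fps"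
    using that by (simp add: fps_deriv_eq_0_iff)
  have inv: "?E h * ?E (- h) = 1" if "fps_nth h 0 = 0" for h
    using that by (intro const) (simp_all add: fps_exp_compose_deriv)
  have "?E (f + g) * ?E (- f) * ?E (- g) = 1"
    using assms by (intro const) (simp_all add: fps_exp_compose_deriv algebra_simps)
  hence "?E (f + g) * (?E f * ?E (- f)) * (?E g * ?E (- g)) = ?E f * ?E g"
    by (simp add: mult_ac)
  thus ?thesis using inv assms by simp
qed

lemma fps_exp_compose_of_nat_mult:
  fixes f :: "'a :: field_char_0 fps"
  assumes "fps_nth f 0 = 0"
  shows "fps_exp 1 oo (of_nat k * f) = (fps_exp 1 oo f) ^ k"
  by (induction k) (use assms in \<open>simp_all add: algebra_simps fps_exp_compose_add\<close>)

text \<open>This is \<open>- log (1 - a X)\<close>; its constant coefficient is \<open>1 / 0 = 0\<close>.\<close>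

definition fps_log_geometric :: "'a :: field_char_0 \<Rightarrow> 'a fps" where
  "fps_log_geometric a = Abs_fps (\<lambda>n. a ^ n / of_nat n)"

lemma fps_log_geometric_nth [simp]: "fps_nth (fps_log_geometric a) n = a ^ n / of_nat n"
  by (simp add: fps_log_geometric_def)

text \<open>The logarithmic series has derivative a / (1 - a X), so the product has derivative 0,
  and its constant coefficient is 1.\<close>

lemma fps_exp_log_geometric:
  fixes a :: "'a :: field_char_0"
  shows "(fps_exp 1 oo fps_log_geometric a) * (1 - fps_const a * fps_X) = 1" (is "?E * ?G = 1")
proof -
  have "fps_deriv (fps_log_geometric a) = fps_const a * Abs_fps (\<lambda>n. a ^ n)"
    by (rule fps_ext) (simp del: of_nat_Suc)
  moreover have "Abs_fps (\<lambda>n. a ^ n) * ?G = 1"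
    by (rule fps_ext) (simp add: right_diff_distrib mult.assoc[symmetric] power_eq_if mult.commute[of _ a])
  ultimately have "fps_deriv (fps_log_geometric a) * ?G = fps_const a"
    by (simp add: mult.assoc)
  moreover have "fps_deriv (?E * ?G) = ?E * (fps_deriv (fps_log_geometric a) * ?G) - ?E * fps_const a"
    by (simp add: fps_exp_compose_deriv algebra_simps flip: fps_const_neg)
  ultimately have "fps_deriv (?E * ?G) = 0"
    by simp
  hence "?E * ?G = fps_const (fps_nth (?E * ?G) 0)"
    by (simp only: fps_deriv_eq_0_iff)
  thus ?thesis by simp
qed

section \<open>The extensions of the base field as finite subfields\<close>

lemma CHAR_prime_finite_field: "prime CHAR('k :: finite_field)"
  by (rule prime_CHAR_semidom) (simp add: finite_imp_CHAR_pos)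

lemma three_neq_0_alg_closure:
  assumes "\<not> 3 dvd CARD('k :: finite_field)"
  shows "(3 :: 'k alg_closure) \<noteq> 0"
proof
  assume "(3 :: 'k alg_closure) = 0"
  hence "of_nat 3 = (0 :: 'k alg_closure)" by simp
  hence "CHAR('k) dvd 3" by (simp only: of_nat_eq_0_iff_char_dvd CHAR_alg_closure)
  moreover have "prime (3 :: nat)" by simp
  ultimately have "CHAR('k) = 3"
    using CHAR_prime_finite_field[where 'k = 'k] primes_dvd_imp_eq by blast
  thus False using assms CHAR_dvd_CARD[where ?'a = 'k] by simp
qed

text \<open>The prime underlying q is the characteristic, so x \<mapsto> x^(q^n) is a power of
  Frobenius and its fixed points are closed under addition.\<close>

lemma finite_subfield_finite_extension:
  assumes "n > 0" "primepow CARD('k)" "\<not> 3 dvd CARD('k :: finite_field)"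
  shows "finite_subfield (finite_extension n :: 'k alg_closure set)"
proof -
  define m where "m = CARD('k) ^ n"
  have mpos: "m > 0" by (simp add: m_def)
  obtain p k where pk: "prime p" "k > 0" "CARD('k) = p ^ k"
    using assms(2) by (auto simp: primepow_def)
  have "CHAR('k) dvd p ^ k"
    using CHAR_dvd_CARD[where ?'a = 'k] pk by simp
  hence p: "p = CHAR('k)"
    using CHAR_prime_finite_field[where 'k = 'k] pk by (metis prime_dvd_power primes_dvd_imp_eq)
  have m: "m = CHAR('k alg_closure) ^ (k * n)"
    unfolding m_def pk p by (simp add: power_mult)
  have add: "(x + y) ^ m = x ^ m + y ^ m" for x y :: "'k alg_closure"
    by (rule freshmans_dream'[OF _ m]) (simp add: CHAR_prime_finite_field)
  \<comment> \<open>Additivity at x and -x gives the sign without a case distinction on the parity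
    of m.\<close>
  have minus: "(- x) ^ m = - (x ^ m)" for x :: "'k alg_closure"
    using add[of x "- x"] mpos by (simp add: eq_neg_iff_add_eq_0 add.commute power_0_left)
  have mem: "x \<in> finite_extension n \<longleftrightarrow> x ^ m = x" for x :: "'k alg_closure"
    by (simp add: finite_extension_def m_def)
  show ?thesis
  proof
    show "finite (finite_extension n :: 'k alg_closure set)"
      using card_finite_extension[OF assms(1), where 'k = 'k] by (intro card_ge_0_finite) simp
    show "(3 :: 'k alg_closure) \<noteq> 0" by (rule three_neq_0_alg_closure[OF assms(3)])
  qed (use mpos in \<open>simp_all add: mem add minus power_mult_distrib power_inverse power_0_left\<close>)
qed

text \<open>A root of X^2 + X + 1 in the closure has cube 1; as q^n is 1 modulo 3, it is fixed by
  the power map and lies in the subfield.\<close>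

lemma finite_subfield_omega_finite_extension:
  assumes "n > 0" "primepow CARD('k :: finite_field)" "\<not> 3 dvd CARD('k)" "CARD('k) ^ n mod 3 = 1"
  obtains \<omega> where "finite_subfield_omega (finite_extension n) (\<omega> :: 'k alg_closure)"
proof -
  interpret finite_subfield "finite_extension n :: 'k alg_closure set"
    by (rule finite_subfield_finite_extension) fact+
  obtain j where j: "CARD('k) ^ n = 3 * j + 1"
    using assms(4) by (metis mult_div_mod_eq)
  obtain \<omega> :: "'k alg_closure" where "poly [:1, 1, 1:] \<omega> = 0"
    using alg_closed_imp_poly_has_root[of "[:1, 1, 1 :: 'k alg_closure:]"] by auto
  hence w: "\<omega> ^ 2 = - 1 - \<omega>"
    by (simp add: power2_eq_square algebra_simps eq_neg_iff_add_eq_0)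
  hence "\<omega> * \<omega> = - 1 - \<omega>"
    by (simp add: power2_eq_square)
  hence "\<omega> ^ 3 = 1"
    by (simp add: power3_eq_cube left_diff_distrib)
  hence "\<omega> \<in> finite_extension n"
    by (simp add: finite_extension_def j power_mult)
  with w show ?thesis
    by (intro that[of \<omega>]) unfold_locales
qed

lemma finite_subfield_cube_inj_finite_extension:
  assumes "n > 0" "primepow CARD('k :: finite_field)" "\<not> 3 dvd CARD('k)" "CARD('k) ^ n mod 3 = 2"
  shows "finite_subfield_cube_inj (finite_extension n :: 'k alg_closure set)"
proof -
  interpret finite_subfield "finite_extension n :: 'k alg_closure set"
    by (rule finite_subfield_finite_extension) fact+
  define m where "m = CARD('k) ^ n"
  obtain j where j: "m = 3 * j + 2"
    using assms(4) unfolding m_def by (metis mult_div_mod_eq)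
  \<comment> \<open>The exponent inverts cubing: 3 (2j + 1) + 1 = 2m, so x times the claimed left
    side is x^(2m) = x^2.\<close>
  have root: "(x ^ 3) ^ (2 * j + 1) = x" if "x \<in> finite_extension n" for x :: "'k alg_closure"
  proof (cases "x = 0")
    case False
    have "x * (x ^ 3) ^ (2 * j + 1) = x ^ (1 + 3 * (2 * j + 1))"
      by (simp only: power_add power_mult power_one_right)
    also have "1 + 3 * (2 * j + 1) = m + m"
      by (simp add: j)
    also have "x ^ (m + m) = x ^ m * x ^ m"
      by (rule power_add)
    also have "x ^ m = x"
      using that by (simp add: finite_extension_def m_def)
    finally show ?thesis
      using False by (simp only: mult_cancel_left simp_thms)
  qed simp
  have "inj_on (\<lambda>x. x ^ 3) (finite_extension n :: 'k alg_closure set)"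
    by (rule inj_on_inverseI[where g = "\<lambda>x. x ^ (2 * j + 1)"]) (rule root)
  thus ?thesis
    by unfold_locales
qed

section \<open>Point counts of the quartic over all extensions\<close>

lemma card_rational_points_burkhardt_quartic:
  fixes n :: nat
  assumes "n > 0" "primepow CARD('k :: finite_field)" "\<not> 3 dvd CARD('k)"
  defines "Q \<equiv> int (CARD('k)) ^ n"
  defines "R \<equiv> int (card (rational_points (burkhardt_quartic :: ('k alg_closure ^ 5) set set) n))"
  shows "Q mod 3 = 1 \<Longrightarrow> R = Q ^ 3 + 16 * Q\<^sup>2 - 29 * Q + 1"
    and "Q mod 3 = 2 \<Longrightarrow> R = Q ^ 3 + 4 * Q\<^sup>2 - Q + 1"
proof -
  define K :: "'k alg_closure set" where "K = finite_extension n"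
  interpret finite_subfield K
    unfolding K_def by (rule finite_subfield_finite_extension) fact+
  have Q: "int (card K) = Q"
    unfolding K_def Q_def using card_finite_extension[OF assms(1)] by simp
  have R: "R = 4 * Q\<^sup>2 - 2 * Q + 2 + (\<Sum>s\<in>K. int (card (affine_cubics s)))"
    unfolding R_def rational_points_def Q[symmetric] K_def[symmetric]
    by (rule card_rational_points_affine)
  have Q_nat: "Q = int (CARD('k) ^ n)" by (simp add: Q_def)
  show "R = Q ^ 3 + 16 * Q\<^sup>2 - 29 * Q + 1" if "Q mod 3 = 1"
  proof -
    have "CARD('k) ^ n mod 3 = 1" using that unfolding Q_nat by presburger
    then obtain \<omega> where "finite_subfield_omega K \<omega>"
      using finite_subfield_omega_finite_extension assms(1-3) unfolding K_def by blast
    then interpret finite_subfield_omega K \<omega> .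
    show ?thesis unfolding R sum_card_affine_cubics_omega Q by simp
  qed
  show "R = Q ^ 3 + 4 * Q\<^sup>2 - Q + 1" if "Q mod 3 = 2"
  proof -
    have "CARD('k) ^ n mod 3 = 2" using that unfolding Q_nat by presburger
    then interpret finite_subfield_cube_inj K
      using finite_subfield_cube_inj_finite_extension assms(1-3) unfolding K_def by blast
    show ?thesis unfolding R sum_card_affine_cubics_cube_inj Q by simp
  qed
qed

lemma Legendre_3:
  "a mod 3 = 1 \<Longrightarrow> Legendre a 3 = 1" "a mod 3 = 2 \<Longrightarrow> Legendre a 3 = -1"
proof -
  assume a: "a mod 3 = 1"
  have "QuadRes 3 a" unfolding QuadRes_def by (rule exI[of _ 1]) (use a in \<open>simp add: cong_def\<close>)
  thus "Legendre a 3 = 1" using a by (simp add: Legendre_def cong_def)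
next
  assume a: "a mod 3 = 2"
  have "(y :: int)\<^sup>2 mod 3 \<noteq> 2" for y
  proof -
    have "y mod 3 = 0 \<or> y mod 3 = 1 \<or> y mod 3 = 2" by presburger
    thus ?thesis unfolding power_mod[of y 3 2, symmetric] by auto
  qed
  hence "\<not> QuadRes 3 a" unfolding QuadRes_def using a by (simp add: cong_def)
  thus "Legendre a 3 = -1" using a by (simp add: Legendre_def cong_def)
qed

text \<open>The sign \<epsilon>^n tells whether q^n is 1 or 2 modulo 3. The two counts have
  quadratic coefficients 16 and 4, that is 10 + 6 and 10 - 6, and linear coefficients -29 and -1,
  that is -15 - 14 and -15 + 14.\<close>

lemma card_rational_points_Legendre:
  fixes n :: nat and \<epsilon> :: rat
  assumes "n > 0" "primepow CARD('k :: finite_field)" "\<not> 3 dvd CARD('k)"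
  defines "q \<equiv> CARD('k)"
  assumes "\<epsilon> = of_int (Legendre (int q) 3)"
  shows "of_nat (card (rational_points (burkhardt_quartic :: ('k alg_closure ^ 5) set set) n)) =
    1 + (of_nat q ^ 3) ^ n + 10 * (of_nat q ^ 2) ^ n + 6 * (\<epsilon> * of_nat q ^ 2) ^ n
      - 15 * of_nat q ^ n - 14 * (\<epsilon> * of_nat q) ^ n"
proof -
  let ?R = "card (rational_points (burkhardt_quartic :: ('k alg_closure ^ 5) set set) n)"
  define Q where "Q = int q ^ n"
  define \<delta> :: int where "\<delta> = (Legendre (int q) 3) ^ n"
  have count: "Q mod 3 = 1 \<Longrightarrow> int ?R = Q ^ 3 + 16 * Q\<^sup>2 - 29 * Q + 1"
    "Q mod 3 = 2 \<Longrightarrow> int ?R = Q ^ 3 + 4 * Q\<^sup>2 - Q + 1"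
    using card_rational_points_burkhardt_quartic[OF assms(1-3)] by (simp_all add: Q_def q_def)
  have "int q mod 3 \<noteq> 0" using assms(3) unfolding q_def by presburger
  hence "int q mod 3 = 1 \<or> int q mod 3 = 2" by presburger
  hence "\<delta> = 1 \<and> Q mod 3 = 1 \<or> \<delta> = -1 \<and> Q mod 3 = 2"
  proof
    assume q: "int q mod 3 = 1"
    hence "Q mod 3 = 1" unfolding Q_def power_mod[of "int q" 3 n, symmetric] by simp
    thus ?thesis using Legendre_3(1)[OF q] by (simp add: \<delta>_def)
  next
    assume q: "int q mod 3 = 2"
    hence "[int q = -1] (mod 3)" by (simp add: cong_def)
    hence "[Q = (-1) ^ n] (mod 3)" unfolding Q_def by (rule cong_pow)
    thus ?thesis using Legendre_3(2)[OF q]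
      by (cases "even n") (simp_all add: \<delta>_def cong_def)
  qed
  hence "int ?R = 1 + Q ^ 3 + 10 * Q\<^sup>2 + 6 * \<delta> * Q\<^sup>2 - 15 * Q - 14 * \<delta> * Q"
    using count by auto
  hence "of_int (int ?R) = (of_int (1 + Q ^ 3 + 10 * Q\<^sup>2 + 6 * \<delta> * Q\<^sup>2 - 15 * Q - 14 * \<delta> * Q) :: rat)"
    by (simp only:)
  moreover have "of_int \<delta> = \<epsilon> ^ n" "of_int Q = (of_nat q :: rat) ^ n"
    by (simp_all add: \<delta>_def assms(5) Q_def)
  ultimately show ?thesis
    by (simp add: power_mult_distrib power_mult[symmetric] mult.commute)
qed

theorem theorem2p2:
  fixes q :: nat and \<epsilon> :: rat
    and B :: "('k :: finite_field alg_closure ^ 5) set set"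
  assumes "q = CARD('k)" and "primepow q" and "\<not> 3 dvd q"
    and "\<epsilon> = of_int (Legendre (int q) 3)"
    and "B = burkhardt_quartic"
  shows "zeta_function B =
      ((1 - fps_const (of_nat q) * fps_X) ^ 15 * (1 - fps_const (\<epsilon> * of_nat q) * fps_X) ^ 14)
      / ((1 - fps_X) * (1 - fps_const (of_nat q ^ 2) * fps_X) ^ 10
          * (1 - fps_const (\<epsilon> * of_nat q ^ 2) * fps_X) ^ 6
          * (1 - fps_const (of_nat q ^ 3) * fps_X))"
proof -
  let ?L = "fps_log_geometric :: rat \<Rightarrow> rat fps"
  let ?E = "\<lambda>f :: rat fps. fps_exp 1 oo f"
  let ?G = "\<lambda>a :: rat. 1 - fps_const a * fps_X"
  let ?q = "of_nat q :: rat"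
  \<comment> \<open>The positive and the negative terms of the count are kept apart, so that all
    multiplicities are natural numbers and become exponents.\<close>
  define P where "P = ?L 1 + ?L (?q ^ 3) + of_nat 10 * ?L (?q ^ 2) + of_nat 6 * ?L (\<epsilon> * ?q ^ 2)"
  define M where "M = of_nat 15 * ?L ?q + of_nat 14 * ?L (\<epsilon> * ?q)"
  have nth_P: "fps_nth P n = (1 + (?q ^ 3) ^ n + 10 * (?q ^ 2) ^ n + 6 * (\<epsilon> * ?q ^ 2) ^ n) / of_nat n" for n
    unfolding P_def fps_of_nat[symmetric] by (simp add: add_divide_distrib)
  have nth_M: "fps_nth M n = (15 * ?q ^ n + 14 * (\<epsilon> * ?q) ^ n) / of_nat n" for n
    unfolding M_def fps_of_nat[symmetric] by (simp add: add_divide_distrib)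
  define S where "S = Abs_fps (\<lambda>n. if n = 0 then 0 else of_nat (card (rational_points B n)) / of_nat n :: rat)"
  have "S + M = P"
  proof (rule fps_ext)
    fix n
    \<comment> \<open>At n = 0 both sides vanish, since division by zero gives 0.\<close>
    show "fps_nth (S + M) n = fps_nth P n"
      using card_rational_points_Legendre[of n, where 'k = 'k and \<epsilon> = \<epsilon>] assms
      by (cases "n = 0") (simp_all add: S_def nth_P nth_M add_divide_distrib[symmetric])
  qed
  have E: "?E (?L a) * ?G a = 1" for a by (rule fps_exp_log_geometric)
  let ?D = "?G 1 * ?G (?q ^ 2) ^ 10 * ?G (\<epsilon> * ?q ^ 2) ^ 6 * ?G (?q ^ 3)"
  let ?N = "?G ?q ^ 15 * ?G (\<epsilon> * ?q) ^ 14"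
  have P: "?E P * ?D = 1"
  proof -
    have "?E P = ?E (?L 1) * ?E (?L (?q ^ 3)) * ?E (?L (?q ^ 2)) ^ 10 * ?E (?L (\<epsilon> * ?q ^ 2)) ^ 6"
      unfolding P_def by (simp only: fps_exp_compose_add fps_exp_compose_of_nat_mult fps_add_nth
        fps_mult_nth_0 fps_log_geometric_nth of_nat_0 div_by_0 mult_zero_right add_0_left)
    hence "?E P * ?D = (?E (?L 1) * ?G 1) * (?E (?L (?q ^ 2)) * ?G (?q ^ 2)) ^ 10
        * (?E (?L (\<epsilon> * ?q ^ 2)) * ?G (\<epsilon> * ?q ^ 2)) ^ 6 * (?E (?L (?q ^ 3)) * ?G (?q ^ 3))"
      by (simp only: power_mult_distrib mult_ac)
    thus ?thesis unfolding E by simp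
  qed
  have M: "?E M * ?N = 1"
  proof -
    have "?E M = ?E (?L ?q) ^ 15 * ?E (?L (\<epsilon> * ?q)) ^ 14"
      unfolding M_def by (simp only: fps_exp_compose_add fps_exp_compose_of_nat_mult fps_add_nth
        fps_mult_nth_0 fps_log_geometric_nth of_nat_0 div_by_0 mult_zero_right add_0_left)
    hence "?E M * ?N = (?E (?L ?q) * ?G ?q) ^ 15 * (?E (?L (\<epsilon> * ?q)) * ?G (\<epsilon> * ?q)) ^ 14"
      by (simp only: power_mult_distrib mult_ac)
    thus ?thesis unfolding E by simp
  qed
  have SM: "?E S * ?E M = ?E P"
    unfolding \<open>S + M = P\<close>[symmetric] by (rule fps_exp_compose_add[symmetric]) (simp_all add: S_def nth_M)
  \<comment> \<open>Here e, m, p stand for the exponentials of \<open>S\<close>, \<open>M\<close>,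
    \<open>P\<close>, and n, d for numerator and denominator. The inverse relations turn e m = p
    into e d = n, and d is nonzero.\<close>
  have quotient: "e = n / d" if "e * m = p" "p * d = 1" "m * n = 1" for e m p n d :: "rat fps"
  proof -
    have "e * d = e * d * (m * n)" using that(3) by simp
    also have "\<dots> = (e * m) * d * n" by (simp only: mult_ac)
    also have "\<dots> = n" using that(1,2) by simp
    finally have "n = e * d" ..
    moreover have "d \<noteq> 0" using that(2) by auto
    ultimately show ?thesis by simp
  qed
  from quotient[OF SM P M] have "?E S = ?N / ?D" .
  thus ?thesis by (simp add: zeta_function_def S_def)
qed

end
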